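(* Let $D\ge 2$, let $\Sigma\in\mathbb{R}^{D\times D}$ be symmetric positive definite with two largest eigenvalues $\lambda_1\ge\lambda_2$ (counted with multiplicity), let $r>0$ and $A=\{v\in\mathbb{R}^D: v^{\mathsf T}\Sigma^{-1}v\le r^2\}$. Then $$\sup_{v,w\in A}\sigma_{\mathcal{E}}(v,w)\ \le\ \sup_{v,w\in A^{(\lambda_1,\lambda_2)}}\sigma_{\mathcal{E}}(v,w)\ \le\ \sup_{v,w\in A^{(\lambda_1,\lambda_1)}}\sigma_{\mathcal{E}}(v,w),$$ where $$A^{(\lambda_1,\lambda_2)}=\Big\{(t_1,t_2)^{\mathsf T}\in\mathbb{R}^2:\tfrac{t_1^2}{\lambda_1}+\tfrac{t_2^2}{\lambda_2}\le r^2\Big\},\qquad A^{(\lambda_1,\lambda_1)}=\Big\{(t_1,t_2)^{\mathsf T}\in\mathbb{R}^2:\tfrac{t_1^2}{\lambda_1}+\tfrac{t_2^2}{\lambda_1}\le r^2\Big\}.$$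
   Context: Write points of $\mathbb{R}^D\times\mathbb{R}^D$ as $x=(x^{(1)},x^{(2)})$, with $x^{flip}=(x^{(2)},x^{(1)})$. Let $u$ be a mean-zero Gaussian field on $\mathbb{R}^D\times\mathbb{R}^D$ with covariance $h(\|x-y\|_2^2)$, assumed four times continuously differentiable in $(x,y)$, with $h:[0,\infty)\to\mathbb{R}$ twice continuously differentiable. Let $f(x)=u(x)-u(x^{flip})$ (a block isotropic Gaussian field), let $\tilde f$ be its second-order Taylor polynomial (with mean-square derivatives) at $z=(z^*,z^* )$, and let $\mathcal{E}=\tilde f-f$. For $v,w\in\mathbb{R}^D$, $\sigma_{\mathcal{E}}(v,w)$ denotes the standard deviation of $\mathcal{E}(z^*+v,z^*+w)$, i.e. inputs are written in coordinates centred at the expansion point. It is given by $$\begin{aligned}\sigma^2_{\mathcal{E}}(v,w)={}&2\Big(h(0)-h\big(2\|v-w\|_2^2\big)\Big)-4\Big(h'(0)-2h'\big(\|v\|_2^2+\|w\|_2^2\big)\Big)\|v-w\|_2^2\\&+4\Big(h''(0)-2h''\big(\|v\|_2^2+\|w\|_2^2\big)\Big)\|v-w\|_2^2\,\|v+w\|_2^2,\end{aligned}$$ and for $v,w\in\mathbb{R}^2$ the quantity $\sigma_{\mathcal{E}}(v,w)\ge 0$ is defined by the same formula. *)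

theory Defs
  imports
    "HOL-Analysis.Analysis"
    "HOL-Probability.Probability"
    "HOL-Computational_Algebra.Polynomial"
begin

text \<open>
  Random fields are families \<open>u x \<omega>\<close> over a probability space. Degenerate (almost surely
  constant) normal laws count as Gaussian: the field need not be nondegenerate, and linear
  combinations with all coefficients zero must be covered.
\<close>

definition gaussian_rv :: "'a measure \<Rightarrow> ('a \<Rightarrow> real) \<Rightarrow> bool" where
  "gaussian_rv M X \<longleftrightarrow> X \<in> borel_measurable M \<and>
     (\<exists>\<mu> \<sigma>. (\<sigma> > 0 \<and> distributed M lborel X (\<lambda>x. ennreal (normal_density \<mu> \<sigma> x))) \<or>
            (AE \<omega> in M. X \<omega> = \<mu>))"

definition gaussian_field :: "'a measure \<Rightarrow> ('x \<Rightarrow> 'a \<Rightarrow> real) \<Rightarrow> bool" where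
  "gaussian_field M u \<longleftrightarrow>
     (\<forall>S c. finite S \<longrightarrow> gaussian_rv M (\<lambda>\<omega>. \<Sum>x\<in>S. c x * u x \<omega>))"

primrec Ck :: "nat \<Rightarrow> ('a::euclidean_space \<Rightarrow> real) \<Rightarrow> bool" where
  "Ck 0 f \<longleftrightarrow> continuous_on UNIV f"
| "Ck (Suc k) f \<longleftrightarrow> (\<forall>x. f differentiable (at x)) \<and>
     (\<forall>i\<in>Basis. Ck k (\<lambda>x. frechet_derivative f (at x) i))"

text \<open>
  \<open>h\<close> is twice continuously differentiable on the closed half-line, with derivatives \<open>h'\<close> and
  \<open>h''\<close>; these are one-sided at \<open>0\<close>.
\<close>

definition C2_halfline :: "(real \<Rightarrow> real) \<Rightarrow> (real \<Rightarrow> real) \<Rightarrow> (real \<Rightarrow> real) \<Rightarrow> bool" where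
  "C2_halfline h h' h'' \<longleftrightarrow>
     (\<forall>t\<ge>0. (h has_real_derivative h' t) (at t within {0..})) \<and>
     (\<forall>t\<ge>0. (h' has_real_derivative h'' t) (at t within {0..})) \<and>
     continuous_on {0..} h''"

definition flip_difference :: "('x \<times> 'x \<Rightarrow> 'a \<Rightarrow> real) \<Rightarrow> 'x \<times> 'x \<Rightarrow> 'a \<Rightarrow> real" where
  "flip_difference u x \<omega> = u x \<omega> - u (prod.swap x) \<omega>"

text \<open>
  \<open>U\<close> is (a version of) the mean-square derivative of the field \<open>g\<close> at \<open>x\<close> in direction \<open>e\<close>:
  the difference quotients converge to \<open>U\<close> in \<open>L\<^sup>2\<close>. The nonnegative integral is infinite, rather
  than \<open>0\<close>, when the square is not integrable.
\<close>

definition has_ms_derivative ::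
    "'a measure \<Rightarrow> ('x::real_vector \<Rightarrow> 'a \<Rightarrow> real) \<Rightarrow> 'x \<Rightarrow> 'x \<Rightarrow> ('a \<Rightarrow> real) \<Rightarrow> bool" where
  "has_ms_derivative M g e x U \<longleftrightarrow> U \<in> borel_measurable M \<and>
     ((\<lambda>\<epsilon>. \<integral>\<^sup>+\<omega>. ennreal (((g (x + \<epsilon> *\<^sub>R e) \<omega> - g x \<omega>) / \<epsilon> - U \<omega>)\<^sup>2) \<partial>M) \<longlongrightarrow> 0) (at (0::real))"

text \<open>
  \<open>T\<close> is the second-order Taylor polynomial of \<open>g\<close> at \<open>z\<close>, with gradient \<open>G\<close> and Hessian \<open>H\<close> taken
  in mean square. Mean-square derivatives are only determined almost surely, so this is a predicate
  satisfied by every choice of versions.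
\<close>

definition is_ms_taylor2 ::
    "'a measure \<Rightarrow> ('x::euclidean_space \<Rightarrow> 'a \<Rightarrow> real) \<Rightarrow> 'x \<Rightarrow> ('x \<Rightarrow> 'a \<Rightarrow> real) \<Rightarrow> bool" where
  "is_ms_taylor2 M g z T \<longleftrightarrow> (\<exists>G H.
     (\<forall>i\<in>Basis. \<forall>x. has_ms_derivative M g i x (G i x)) \<and>
     (\<forall>i\<in>Basis. \<forall>j\<in>Basis. has_ms_derivative M (G i) j z (H i j)) \<and>
     (\<forall>x \<omega>. T x \<omega> = g z \<omega> + (\<Sum>i\<in>Basis. ((x - z) \<bullet> i) * G i z \<omega>)
        + 1/2 * (\<Sum>i\<in>Basis. \<Sum>j\<in>Basis. ((x - z) \<bullet> i) * ((x - z) \<bullet> j) * H i j \<omega>)))"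

definition taylor_error_sd ::
    "'a measure \<Rightarrow> ('x::plus \<times> 'x \<Rightarrow> 'a \<Rightarrow> real) \<Rightarrow> ('x \<times> 'x \<Rightarrow> 'a \<Rightarrow> real) \<Rightarrow> 'x \<Rightarrow> 'x \<Rightarrow> 'x \<Rightarrow> real"
  where
  "taylor_error_sd M f T zs v w =
     sqrt (prob_space.variance M (\<lambda>\<omega>. T (zs + v, zs + w) \<omega> - f (zs + v, zs + w) \<omega>))"

text \<open>The closed formula, used to define the quantity for planar arguments.\<close>

definition sigma_formula ::
    "(real \<Rightarrow> real) \<Rightarrow> (real \<Rightarrow> real) \<Rightarrow> (real \<Rightarrow> real) \<Rightarrow> 'v::real_normed_vector \<Rightarrow> 'v \<Rightarrow> real" where
  "sigma_formula h h' h'' v w = sqrt (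
       2 * (h 0 - h (2 * (norm (v - w))\<^sup>2))
     - 4 * (h' 0 - 2 * h' ((norm v)\<^sup>2 + (norm w)\<^sup>2)) * (norm (v - w))\<^sup>2
     + 4 * (h'' 0 - 2 * h'' ((norm v)\<^sup>2 + (norm w)\<^sup>2)) * (norm (v - w))\<^sup>2 * (norm (v + w))\<^sup>2)"

definition symmetric_posdef :: "real^'n^'n \<Rightarrow> bool" where
  "symmetric_posdef S \<longleftrightarrow> transpose S = S \<and> (\<forall>x. x \<noteq> 0 \<longrightarrow> x \<bullet> (S *v x) > 0)"

definition charpoly :: "real^'n^'n \<Rightarrow> real poly" where
  "charpoly S = det (\<chi> i j. if i = j then [:- (S $ i $ j), 1:] else [:- (S $ i $ j):])"

text \<open>The real eigenvalues, repeated according to multiplicity, in decreasing order.\<close>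

definition eigenvalues_desc :: "real^'n^'n \<Rightarrow> real list" where
  "eigenvalues_desc S = rev (sorted_list_of_multiset (proots (charpoly S)))"

definition ellipsoid :: "real^'n^'n \<Rightarrow> real \<Rightarrow> (real^'n) set" where
  "ellipsoid S r = {v. v \<bullet> (matrix_inv S *v v) \<le> r\<^sup>2}"

definition ellipse :: "real \<Rightarrow> real \<Rightarrow> real \<Rightarrow> (real^2) set" where
  "ellipse a b r = {t. (t $ 1)\<^sup>2 / a + (t $ 2)\<^sup>2 / b \<le> r\<^sup>2}"

end

theory Submission
  imports Defs
begin

text \<open>
  The standard deviation of the Taylor error at \<open>(v, w)\<close> is given by a closed formula that sees
  \<open>v\<close> and \<open>w\<close> only through \<open>v \<bullet> v\<close>, \<open>w \<bullet> w\<close> and \<open>v \<bullet> w\<close>. It therefore suffices to realise every pair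
  of points of the ellipsoid, up to isometry, in the plane ellipse with semi-axes
  \<open>r * sqrt l1\<close> and \<open>r * sqrt l2\<close>. A pair \<open>v, w\<close> lies in some plane, and that plane contains a unit
  vector \<open>u\<close> orthogonal to a leading eigenvector \<open>b\<close> of \<open>S\<close>. The form of the inverse matrix equals
  \<open>1 / l1\<close> along \<open>b\<close>, is at least \<open>1 / l2\<close> on the orthogonal complement of \<open>b\<close>, and has no cross term
  between the two. As the whole \<open>b\<close>-component of a vector of the plane comes from its part
  along the unit vector \<open>e\<close> of the plane orthogonal to \<open>u\<close>, the coordinates \<open>(v \<bullet> e, v \<bullet> u)\<close> satisfy
  the inequality of the plane ellipse (\<open>planar_section_in_ellipse\<close>).
  The second inequality is monotonicity of the supremum,
  because \<open>l2 \<le> l1\<close>. As real suprema carry information only for bounded sets,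
  the argument also uses that the formula is continuous on the compact ellipses
  (\<open>bdd_above_sigma_formula_ellipse\<close>).

  The eigenvalues are roots of the characteristic polynomial, with multiplicity. The link with
  the quadratic form is the spectral theorem: an orthonormal eigenbasis factors the characteristic
  polynomial (\<open>charpoly_eigenbasis\<close>), so the two leading roots belong to two different members
  of the basis even when they coincide (\<open>two_largest_eigenvalues\<close>).

  The closed formula (\<open>variance_taylor_error\<close>) is an \<open>L\<^sup>2\<close> computation. Covariances pass to
  mean-square limits, so the covariances of the field \<open>f\<close>, its gradient \<open>G\<close> and its Hessian
  \<open>H\<close> are obtained by differentiating the covariance kernel of \<open>f\<close>, one variable at a time.
  The covariance of \<open>H\<close> with itself is read off from a diagonal limit, in which both
  difference quotients of \<open>G\<close> use the same increment; it is then determined by the second-order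
  expansion of the radial profile \<open>h\<close> at the origin.
\<close>

section \<open>Spectral theorem for real symmetric matrices\<close>

text \<open>
  The first-order condition at a maximum, in algebraic form: near \<open>0\<close> the linear term dominates.
\<close>

lemma linear_term_zero_if_quadratic_nonpos:
  fixes c d :: real
  assumes "\<And>t. 2 * t * c + t\<^sup>2 * d \<le> 0"
  shows "c = 0"
proof (rule ccontr)
  assume "c \<noteq> 0"
  define t where "t = c / (\<bar>d\<bar> + 1)"
  have t: "t * (\<bar>d\<bar> + 1) = c" by (simp add: t_def)
  have "t \<noteq> 0" using \<open>c \<noteq> 0\<close> t by auto
  have "2 * t * c + t\<^sup>2 * d = t\<^sup>2 * (2 * (\<bar>d\<bar> + 1) + d)"
    by (simp add: t[symmetric] power2_eq_square algebra_simps)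
  moreover have "t\<^sup>2 * (2 * (\<bar>d\<bar> + 1) + d) > 0"
    using \<open>t \<noteq> 0\<close> by (intro mult_pos_pos) auto
  ultimately show False using assms[of t] by linarith
qed

lemma symmetric_inner_matrix:
  fixes S :: "real^'n^'n"
  assumes "transpose S = S"
  shows "x \<bullet> (S *v y) = (S *v x) \<bullet> y"
  using dot_lmul_matrix[of x S y] assms by (metis transpose_matrix_vector)

text \<open>
  The orthogonal complement \<open>W\<close> of a set of eigenvectors is invariant under a symmetric matrix. A
  maximiser \<open>e\<close> of the quadratic form on the unit sphere of \<open>W\<close> is an eigenvector, because
  the first-order condition makes \<open>S *v e\<close> orthogonal to every vector of \<open>W\<close> that is orthogonal
  to \<open>e\<close>, in particular to \<open>S *v e - l *\<^sub>R e\<close>.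
\<close>

lemma symmetric_eigenvector_orthogonal:
  fixes S :: "real^'n^'n"
  assumes sym: "transpose S = S"
    and B: "finite B" "card B < CARD('n)" "\<And>b. b \<in> B \<Longrightarrow> \<exists>l. S *v b = l *\<^sub>R b"
  obtains e l where "norm e = 1" "\<And>b. b \<in> B \<Longrightarrow> b \<bullet> e = 0" "S *v e = l *\<^sub>R e"
proof -
  define W where "W = {y. \<forall>b\<in>B. orthogonal b y}"
  have subW: "subspace W" unfolding W_def by (rule subspace_orthogonal_to_vectors)
  have SW: "S *v y \<in> W" if "y \<in> W" for y
    unfolding W_def orthogonal_def
  proof (intro CollectI ballI)
    fix b assume b: "b \<in> B"
    obtain l where "S *v b = l *\<^sub>R b" using B(3)[OF b] by blast
    then show "b \<bullet> (S *v y) = 0"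
      using that b by (simp add: symmetric_inner_matrix[OF sym] W_def orthogonal_def)
  qed
  define K where "K = sphere 0 1 \<inter> W"
  have "compact K" unfolding K_def
    by (intro compact_Int_closed compact_sphere closed_subspace subW)
  moreover have "K \<noteq> {}"
  proof -
    \<comment> \<open>Fewer than \<open>CARD('n)\<close> vectors leave a nonzero orthogonal complement.\<close>
    have "dim (span B) < DIM(real^'n)"
      using dim_le_card'[OF B(1)] B(2) by (simp add: dim_span)
    then have "span B \<noteq> UNIV" by (metis dim_UNIV nat_less_le)
    then obtain y where y: "y \<noteq> 0" "\<And>b. b \<in> span B \<Longrightarrow> orthogonal y b"
      using orthogonal_to_subspace_exists[of B] \<open>dim (span B) < _\<close> by (auto simp: dim_span)
    then have "y /\<^sub>R norm y \<in> K"
      by (auto simp: K_def W_def orthogonal_def inner_commute span_base)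
    then show ?thesis by blast
  qed
  moreover have "continuous_on K (\<lambda>x. x \<bullet> (S *v x))"
    by (intro continuous_intros matrix_vector_mult_linear_continuous_on)
  ultimately obtain e where e: "e \<in> K" and max: "\<And>y. y \<in> K \<Longrightarrow> y \<bullet> (S *v y) \<le> e \<bullet> (S *v e)"
    using continuous_attains_sup[of K "\<lambda>x. x \<bullet> (S *v x)"] by blast
  define l where "l = e \<bullet> (S *v e)"
  have eW: "e \<in> W" and e1: "norm e = 1" "e \<bullet> e = 1"
    using e by (auto simp: K_def norm_eq_1)
  have maxW: "y \<bullet> (S *v y) \<le> l * (y \<bullet> y)" if "y \<in> W" for y
  proof (cases "y = 0")
    case False
    have "y /\<^sub>R norm y \<in> K"
      using that False subspace_scale[OF subW] by (simp add: K_def)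
    from max[OF this] have "(y \<bullet> (S *v y)) / (norm y)\<^sup>2 \<le> l"
      using False by (simp add: l_def matrix_vector_mult_scaleR power2_eq_square divide_inverse algebra_simps)
    then show ?thesis using False by (simp add: power2_norm_eq_inner divide_le_eq)
  qed simp
  have orth: "y \<bullet> (S *v e) = 0" if y: "y \<in> W" "y \<bullet> e = 0" for y
  proof (rule linear_term_zero_if_quadratic_nonpos)
    fix t :: real
    have "e + t *\<^sub>R y \<in> W" using eW y subW by (simp add: subspace_add subspace_scale)
    from maxW[OF this] show "2 * t * (y \<bullet> (S *v e)) + t\<^sup>2 * (y \<bullet> (S *v y) - l * (y \<bullet> y)) \<le> 0"
      using y e1 symmetric_inner_matrix[OF sym, of e y]
      by (simp add: l_def inner_simps matrix_vector_right_distrib matrix_vector_mult_scaleR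
          inner_commute power2_eq_square algebra_simps)
  qed
  define d where "d = S *v e - l *\<^sub>R e"
  have "d \<in> W" using SW[OF eW] eW subW by (simp add: d_def subspace_diff subspace_scale)
  moreover have de: "d \<bullet> e = 0" by (simp add: d_def l_def inner_simps e1 inner_commute)
  ultimately have "d \<bullet> (S *v e) = 0" by (rule orth)
  then have "d \<bullet> d = 0" using de by (subst (2) d_def) (simp add: inner_simps)
  then have "S *v e = l *\<^sub>R e" by (simp add: d_def)
  moreover have "b \<bullet> e = 0" if "b \<in> B" for b
    using eW that by (auto simp: W_def orthogonal_def)
  ultimately show ?thesis using that e1 by blast
qed

lemma symmetric_orthonormal_eigenvectors:
  fixes S :: "real^'n^'n"
  assumes sym: "transpose S = S" and "k \<le> CARD('n)"
  shows "\<exists>B. finite B \<and> card B = k \<and> (\<forall>b\<in>B. norm b = 1 \<and> (\<exists>l. S *v b = l *\<^sub>R b))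
           \<and> (\<forall>b\<in>B. \<forall>c\<in>B. b \<noteq> c \<longrightarrow> b \<bullet> c = 0)"
  using assms(2)
proof (induction k)
  case 0
  show ?case by (intro exI[of _ "{}"]) simp
next
  case (Suc k)
  then obtain B where B: "finite B" "card B = k" "\<And>b. b \<in> B \<Longrightarrow> norm b = 1"
      "\<And>b. b \<in> B \<Longrightarrow> \<exists>l. S *v b = l *\<^sub>R b"
      "\<And>b c. b \<in> B \<Longrightarrow> c \<in> B \<Longrightarrow> b \<noteq> c \<Longrightarrow> b \<bullet> c = 0"
    by auto
  obtain e l where e: "norm e = 1" "\<And>b. b \<in> B \<Longrightarrow> b \<bullet> e = 0" "S *v e = l *\<^sub>R e"
    using symmetric_eigenvector_orthogonal[OF sym B(1) _ B(4)] B(2) Suc.prems by auto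
  have "e \<notin> B" using e(1) e(2)[of e] by auto
  then show ?case
    using B e by (intro exI[of _ "insert e B"]) (auto simp: inner_commute)
qed

lemma symmetric_matrix_eigenbasis:
  fixes S :: "real^'n^'n"
  assumes "transpose S = S"
  obtains b :: "'n \<Rightarrow> real^'n" and \<mu> :: "'n \<Rightarrow> real"
  where "\<And>i j. b i \<bullet> b j = (if i = j then 1 else 0)" "\<And>i. S *v b i = \<mu> i *\<^sub>R b i"
proof -
  obtain B where B: "finite B" "card B = CARD('n)" "\<And>b. b \<in> B \<Longrightarrow> norm b = 1"
      "\<And>b. b \<in> B \<Longrightarrow> \<exists>l. S *v b = l *\<^sub>R b"
      "\<And>b c. b \<in> B \<Longrightarrow> c \<in> B \<Longrightarrow> b \<noteq> c \<Longrightarrow> b \<bullet> c = 0"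
    using symmetric_orthonormal_eigenvectors[OF assms order.refl] by auto
  obtain b :: "'n \<Rightarrow> real^'n" where b: "bij_betw b UNIV B"
    using finite_same_card_bij[OF finite_class.finite_UNIV B(1)] B(2) by auto
  have bB: "b i \<in> B" for i using b by (auto simp: bij_betw_def)
  have inj: "b i = b j \<longleftrightarrow> i = j" for i j using b by (auto simp: bij_betw_def inj_on_def)
  obtain \<mu> where "\<And>i. S *v b i = \<mu> i *\<^sub>R b i" using B(4)[OF bB] by metis
  moreover have "b i \<bullet> b j = (if i = j then 1 else 0)" for i j
    using B(3)[OF bB] B(5)[OF bB bB] inj by (auto simp: norm_eq_1)
  ultimately show ?thesis using that by blast
qed

text \<open>
  The matrix \<open>Q\<close> with rows \<open>b i\<close> is orthogonal, and the sum is \<open>transpose Q *v (Q *v x)\<close>.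
\<close>

lemma orthonormal_expansion:
  fixes b :: "'n \<Rightarrow> real^'n"
  assumes orth: "\<And>i j. b i \<bullet> b j = (if i = j then 1 else 0)"
  shows "(\<Sum>i\<in>UNIV. (x \<bullet> b i) *\<^sub>R b i) = x"
proof -
  define Q :: "real^'n^'n" where "Q = (\<chi> i. b i)"
  have "Q ** transpose Q = mat 1"
    using orth by (simp add: Q_def matrix_matrix_mult_def transpose_def mat_def vec_eq_iff inner_vec_def)
  then have "transpose Q ** Q = mat 1" by (simp add: matrix_left_right_inverse)
  then have "transpose Q *v (Q *v x) = x" by (simp add: matrix_vector_mul_assoc)
  moreover have "transpose Q *v (Q *v x) = (\<Sum>i\<in>UNIV. (x \<bullet> b i) *\<^sub>R b i)"
    by (simp add: Q_def matrix_vector_mult_def transpose_def vec_eq_iff inner_vec_def mult.commute)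
  ultimately show ?thesis by simp
qed

section \<open>The two largest roots of the characteristic polynomial\<close>

lemma poly_det:
  fixes A :: "real poly^'n^'n"
  shows "poly (det A) x = det (\<chi> i j. poly (A $ i $ j) x)"
  by (simp add: det_def poly_sum poly_prod)

text \<open>
  Real polynomials are determined by their values. At a number \<open>x\<close> the characteristic
  polynomial is \<open>det (mat x - S)\<close>, which the change of basis to the \<open>b i\<close> turns into a diagonal
  determinant.
\<close>

lemma charpoly_eigenbasis:
  fixes S :: "real^'n^'n" and b :: "'n \<Rightarrow> real^'n"
  assumes orth: "\<And>i j. b i \<bullet> b j = (if i = j then 1 else 0)"
    and eig: "\<And>i. S *v b i = \<mu> i *\<^sub>R b i"
  shows "charpoly S = (\<Prod>i\<in>UNIV. [:- \<mu> i, 1:])"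
proof (rule poly_eq_poly_eq_iff[THEN iffD1], rule ext)
  fix x :: real
  define P :: "real^'n^'n" where "P = transpose (\<chi> i. b i)"
  define D :: "real^'n^'n" where "D = (\<chi> i j. if i = j then x - \<mu> i else 0)"
  have "transpose P ** P = mat 1"
    using orth by (simp add: P_def matrix_matrix_mult_def transpose_def mat_def vec_eq_iff inner_vec_def)
  then have "det (transpose P) * det P = 1" by (metis det_I det_mul)
  then have P0: "det P \<noteq> 0" by auto
  have "(mat x - S) ** P = P ** D"
  proof -
    have "((mat x - S) ** P) $ i $ j = (P ** D) $ i $ j" for i j
    proof -
      have "((mat x - S) ** P) $ i $ j = ((mat x - S) *v b j) $ i"
        by (simp add: matrix_matrix_mult_def matrix_vector_mult_def P_def transpose_def)
      also have "(mat x - S) *v b j = x *\<^sub>R b j - \<mu> j *\<^sub>R b j"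
      proof -
        have "mat x *v b j = x *\<^sub>R b j"
          by (simp add: vec_eq_iff matrix_vector_mult_def mat_def
              if_distrib[of "\<lambda>c. c * _"] cong: if_cong)
        then show ?thesis by (simp add: matrix_vector_mult_diff_rdistrib eig)
      qed
      also have "\<dots> $ i = (P ** D) $ i $ j"
        by (simp add: matrix_matrix_mult_def P_def D_def transpose_def algebra_simps
            if_distrib[of "\<lambda>c. _ * c"] cong: if_cong)
      finally show ?thesis .
    qed
    then show ?thesis by (simp add: vec_eq_iff)
  qed
  then have "det (mat x - S) * det P = det P * det D" by (metis det_mul)
  then have "det (mat x - S) = det D" using P0 by simp
  moreover have "det D = (\<Prod>i\<in>UNIV. x - \<mu> i)"
    by (subst det_diagonal) (simp_all add: D_def)
  moreover have "poly (charpoly S) x = det (mat x - S)"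
  proof -
    have "(\<chi> i j. poly ((\<chi> i j. if i = j then [:- (S $ i $ j), 1:] else [:- (S $ i $ j):]) $ i $ j) x)
        = mat x - S"
      by (simp add: vec_eq_iff mat_def)
    then show ?thesis unfolding charpoly_def poly_det by simp
  qed
  ultimately show "poly (charpoly S) x = poly (\<Prod>i\<in>UNIV. [:- \<mu> i, 1:]) x"
    by (simp add: poly_prod)
qed

text \<open>
  Sorting the indices, rather than the eigenvalues, keeps multiple eigenvalues attached to
  different members of the basis. This is what makes \<open>\<mu> q\<close> a bound on the whole complement
  of \<open>b p\<close>.
\<close>

lemma two_largest_eigenvalues:
  fixes S :: "real^'n^'n" and b :: "'n \<Rightarrow> real^'n"
  assumes orth: "\<And>i j. b i \<bullet> b j = (if i = j then 1 else 0)"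
    and eig: "\<And>i. S *v b i = \<mu> i *\<^sub>R b i" and card: "CARD('n) \<ge> 2"
  obtains p q where "p \<noteq> q" "eigenvalues_desc S ! 0 = \<mu> p" "eigenvalues_desc S ! 1 = \<mu> q"
    "\<mu> q \<le> \<mu> p" "\<And>i. i \<noteq> p \<Longrightarrow> \<mu> i \<le> \<mu> q"
proof -
  obtain ys :: "'n list" where ys: "set ys = UNIV" "distinct ys"
    using finite_distinct_list[OF finite_class.finite_UNIV] by blast
  define xs where "xs = sort_key (\<lambda>i. - \<mu> i) ys"
  have xs: "set xs = UNIV" "distinct xs" using ys by (simp_all add: xs_def)
  then have len: "length xs = CARD('n)" by (metis distinct_card)
  have "sorted (map (\<lambda>i. - \<mu> i) xs)" unfolding xs_def by (rule sorted_sort_key)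
  then have anti: "\<mu> (xs ! j) \<le> \<mu> (xs ! i)" if "i \<le> j" "j < length xs" for i j
    using that sorted_nth_mono by fastforce
  have "proots (charpoly S) = image_mset \<mu> (mset_set UNIV)"
    unfolding charpoly_eigenbasis[OF orth eig]
    by (subst proots_prod) (auto simp: sum_unfold_sum_mset)
  also have "mset_set UNIV = mset xs" using xs by (metis mset_set_set)
  finally have "proots (charpoly S) = mset (rev (map \<mu> xs))" by simp
  moreover have "sorted (rev (map \<mu> xs))"
    unfolding sorted_rev_iff_nth_mono using anti by simp
  ultimately have desc: "eigenvalues_desc S = map \<mu> xs"
    unfolding eigenvalues_desc_def by (metis rev_rev_ident sorted_list_of_multiset_mset sorted_sort_id)
  have "\<mu> i \<le> \<mu> (xs ! 1)" if i: "i \<noteq> xs ! 0" for i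
  proof -
    obtain k where k: "k < length xs" "xs ! k = i" using xs(1) by (metis UNIV_I in_set_conv_nth)
    then have "1 \<le> k" using i by (cases k) auto
    then show ?thesis using anti[of 1 k] k by simp
  qed
  moreover have "xs ! 0 \<noteq> xs ! 1" using xs(2) len card by (simp add: nth_eq_iff_index_eq)
  moreover have "\<mu> (xs ! 1) \<le> \<mu> (xs ! 0)" using anti[of 0 1] len card by simp
  moreover have "eigenvalues_desc S ! 0 = \<mu> (xs ! 0)" "eigenvalues_desc S ! 1 = \<mu> (xs ! 1)"
    using len card by (simp_all add: desc)
  ultimately show ?thesis using that[of "xs ! 0" "xs ! 1"] by blast
qed

section \<open>Plane sections of an ellipsoid\<close>

text \<open>
  One Gram--Schmidt step. If \<open>w\<close> is a multiple of \<open>e\<close>, the new vector is an arbitrary unit vector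
  orthogonal to \<open>e\<close>, and this is where dimension at least two enters.
\<close>

lemma unit_vector_completing_span:
  fixes e w :: "'x::euclidean_space"
  assumes "DIM('x) \<ge> 2" and e: "e \<bullet> e = 1"
  obtains u where "u \<bullet> u = 1" "e \<bullet> u = 0" "w = (w \<bullet> e) *\<^sub>R e + (w \<bullet> u) *\<^sub>R u"
proof -
  define d where "d = w - (w \<bullet> e) *\<^sub>R e"
  have de: "d \<bullet> e = 0" by (simp add: d_def inner_simps e)
  show ?thesis
  proof (cases "d = 0")
    case True
    obtain y where y: "y \<noteq> 0" "orthogonal e y" using orthogonal_to_vector_exists[OF assms(1)] by blast
    define u where "u = y /\<^sub>R norm y"
    have u: "u \<bullet> u = 1" "e \<bullet> u = 0"
      using y by (simp_all add: u_def orthogonal_def power2_norm_eq_inner[symmetric] power2_eq_square)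
    have "w \<bullet> u = (w \<bullet> e) * (e \<bullet> u)" using True by (metis d_def eq_iff_diff_eq_0 inner_scaleR_left)
    with True u show ?thesis by (intro that[of u]) (simp_all add: d_def)
  next
    case False
    define u where "u = d /\<^sub>R norm d"
    have u: "u \<bullet> u = 1" "e \<bullet> u = 0"
      using False de by (simp_all add: u_def inner_commute power2_norm_eq_inner[symmetric] power2_eq_square)
    have "d = norm d *\<^sub>R u" using False by (simp add: u_def)
    then have w: "w = (w \<bullet> e) *\<^sub>R e + norm d *\<^sub>R u" by (simp add: d_def)
    have "w \<bullet> u = ((w \<bullet> e) *\<^sub>R e + norm d *\<^sub>R u) \<bullet> u" using w by (rule arg_cong)
    also have "\<dots> = norm d" using u by (simp add: inner_add_left)
    finally have "w \<bullet> u = norm d" .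
    with u w show ?thesis by (intro that[of u]) simp_all
  qed
qed

text \<open>
  A plane through \<open>v\<close> and \<open>w\<close> has a direction orthogonal to a given \<open>b\<close>, because \<open>x \<bullet> b = 0\<close> is a
  single linear condition on the plane. An orthonormal basis of the plane is
  rotated so that its second vector takes this direction.
\<close>

lemma planar_frame_orthogonal_to:
  fixes v w b :: "'x::euclidean_space"
  assumes dim: "DIM('x) \<ge> 2"
  obtains e u where "e \<bullet> e = 1" "u \<bullet> u = 1" "e \<bullet> u = 0" "u \<bullet> b = 0"
    "v = (v \<bullet> e) *\<^sub>R e + (v \<bullet> u) *\<^sub>R u" "w = (w \<bullet> e) *\<^sub>R e + (w \<bullet> u) *\<^sub>R u"
proof -
  obtain i :: 'x where i: "i \<in> Basis" using nonempty_Basis by blast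
  obtain e0 where e0: "e0 \<bullet> e0 = 1" "v = (v \<bullet> e0) *\<^sub>R e0"
  proof (cases "v = 0")
    case True
    then show ?thesis using that[of i] i by simp
  next
    case False
    then show ?thesis using that[of "v /\<^sub>R norm v"]
      by (simp add: dot_square_norm power2_eq_square field_simps)
  qed
  obtain u0 where u0: "u0 \<bullet> u0 = 1" "e0 \<bullet> u0 = 0" "w = (w \<bullet> e0) *\<^sub>R e0 + (w \<bullet> u0) *\<^sub>R u0"
    using unit_vector_completing_span[OF dim e0(1)] .
  have vu: "v \<bullet> u0 = 0" using e0(2) u0(2) by (metis inner_scaleR_left mult_zero_right)
  define \<alpha> \<beta> where "\<alpha> = e0 \<bullet> b" and "\<beta> = u0 \<bullet> b"
  show ?thesis
  proof (cases "\<beta> = 0")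
    case True
    then show ?thesis using that[of e0 u0] e0 u0 vu by (simp add: \<beta>_def)
  next
    case False
    define \<rho> where "\<rho> = sqrt (\<alpha>\<^sup>2 + \<beta>\<^sup>2)"
    have \<rho>: "\<rho> \<noteq> 0" "\<rho>\<^sup>2 = \<alpha>\<^sup>2 + \<beta>\<^sup>2"
      using False by (simp_all add: \<rho>_def sum_power2_eq_zero_iff)
    \<comment> \<open>The rotation that makes the component of \<open>b\<close> along the second vector vanish.\<close>
    define c s where "c = \<alpha> / \<rho>" and "s = \<beta> / \<rho>"
    have cs: "c\<^sup>2 + s\<^sup>2 = 1"
      using \<rho> False by (simp add: c_def s_def power_divide add_divide_distrib[symmetric] sum_power2_eq_zero_iff)
    define e u where "e = c *\<^sub>R e0 + s *\<^sub>R u0" and "u = s *\<^sub>R e0 - c *\<^sub>R u0"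
    have u0e0: "u0 \<bullet> e0 = 0" using u0(2) by (simp add: inner_commute)
    have 1: "e \<bullet> e = 1" "u \<bullet> u = 1" "e \<bullet> u = 0"
      using cs by (simp_all add: e_def u_def inner_simps e0(1) u0 u0e0 power2_eq_square)
    have 2: "u \<bullet> b = 0"
      by (simp add: u_def inner_simps \<alpha>_def[symmetric] \<beta>_def[symmetric]) (simp add: c_def s_def)
    have 3: "x = (x \<bullet> e) *\<^sub>R e + (x \<bullet> u) *\<^sub>R u"
      if x: "x = (x \<bullet> e0) *\<^sub>R e0 + (x \<bullet> u0) *\<^sub>R u0" for x
    proof -
      have "(x \<bullet> e) *\<^sub>R e + (x \<bullet> u) *\<^sub>R u
          = ((c\<^sup>2 + s\<^sup>2) * (x \<bullet> e0)) *\<^sub>R e0 + ((c\<^sup>2 + s\<^sup>2) * (x \<bullet> u0)) *\<^sub>R u0"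
        by (simp add: e_def u_def inner_simps algebra_simps power2_eq_square)
      then show ?thesis using cs x by simp
    qed
    have "v = (v \<bullet> e0) *\<^sub>R e0 + (v \<bullet> u0) *\<^sub>R u0" using e0(2) vu by simp
    with 1 2 3 u0(3) show ?thesis by (intro that[of e u]) blast+
  qed
qed

lemma inner_planar_coordinates:
  fixes x y e u :: "'x::real_inner"
  assumes "e \<bullet> e = 1" "u \<bullet> u = 1" "e \<bullet> u = 0"
    and x: "x = (x \<bullet> e) *\<^sub>R e + (x \<bullet> u) *\<^sub>R u" and y: "y = (y \<bullet> e) *\<^sub>R e + (y \<bullet> u) *\<^sub>R u"
  shows "vector [x \<bullet> e, x \<bullet> u] \<bullet> (vector [y \<bullet> e, y \<bullet> u] :: real^2) = x \<bullet> y"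
proof -
  have "x \<bullet> y = (x \<bullet> e) * (y \<bullet> e) + (x \<bullet> u) * (y \<bullet> u)"
    by (subst y) (simp add: inner_simps)
  then show ?thesis by (simp add: inner_vec_def sum_2)
qed

text \<open>
  In the eigenbasis, \<open>S\<close> multiplies the coordinates by \<open>\<mu> i\<close>, so its inverse divides by \<open>\<mu> i\<close>.
\<close>

lemma inner_matrix_inv_eigenbasis:
  fixes S :: "real^'n^'n" and b :: "'n \<Rightarrow> real^'n"
  assumes sym: "transpose S = S" and orth: "\<And>i j. b i \<bullet> b j = (if i = j then 1 else 0)"
    and eig: "\<And>i. S *v b i = \<mu> i *\<^sub>R b i" and pos: "\<And>i. \<mu> i > 0"
  shows "v \<bullet> (matrix_inv S *v v) = (\<Sum>i\<in>UNIV. (v \<bullet> b i)\<^sup>2 / \<mu> i)"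
proof -
  have "x = 0" if "S *v x = 0" for x
  proof -
    have "x \<bullet> b i = 0" for i
    proof -
      have "\<mu> i * (x \<bullet> b i) = (S *v x) \<bullet> b i"
        using symmetric_inner_matrix[OF sym, of x "b i"] by (simp add: eig)
      then show ?thesis using that pos[of i] by simp
    qed
    then show ?thesis using orthonormal_expansion[OF orth, of x] by simp
  qed
  then have "invertible S"
    using matrix_left_invertible_ker[of S] invertible_left_inverse[of S] by blast
  then have inv: "S ** matrix_inv S = mat 1"
    unfolding invertible_def matrix_inv_def by (metis (mono_tags, lifting) someI_ex)
  define y where "y = matrix_inv S *v v"
  have Sy: "S *v y = v" using inv by (simp add: y_def matrix_vector_mul_assoc)
  have yb: "y \<bullet> b i = (v \<bullet> b i) / \<mu> i" for i
  proof -
    have "v \<bullet> b i = \<mu> i * (y \<bullet> b i)"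
      using symmetric_inner_matrix[OF sym, of y "b i"] by (simp add: eig Sy)
    then show ?thesis using pos[of i] by simp
  qed
  have "v \<bullet> y = v \<bullet> (\<Sum>i\<in>UNIV. (y \<bullet> b i) *\<^sub>R b i)"
    by (simp only: orthonormal_expansion[OF orth])
  also have "\<dots> = (\<Sum>i\<in>UNIV. (v \<bullet> b i)\<^sup>2 / \<mu> i)"
    by (simp add: inner_sum_right yb power2_eq_square)
  finally show ?thesis by (simp add: y_def)
qed

text \<open>
  Let \<open>\<alpha>, \<beta>\<close> be the coordinates of \<open>v\<close> and \<open>\<kappa> = e \<bullet> b p\<close>. Since \<open>u\<close> is orthogonal to \<open>b p\<close>, the
  leading component of \<open>v\<close> is \<open>\<alpha> * \<kappa>\<close>, and the remaining squared length is
  \<open>\<alpha>\<^sup>2 * (1 - \<kappa>\<^sup>2) + \<beta>\<^sup>2\<close>. The form of the inverse matrix is at least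
  \<open>(\<alpha> * \<kappa>)\<^sup>2 / \<mu> p + (\<alpha>\<^sup>2 * (1 - \<kappa>\<^sup>2) + \<beta>\<^sup>2) / \<mu> q\<close>. As \<open>\<mu> q \<le> \<mu> p\<close> and \<open>\<kappa>\<^sup>2 \<le> 1\<close>, replacing the middle
  denominator by \<open>\<mu> p\<close> only decreases this, and gives \<open>\<alpha>\<^sup>2 / \<mu> p + \<beta>\<^sup>2 / \<mu> q\<close>.
\<close>

lemma planar_section_in_ellipse:
  fixes S :: "real^'n^'n" and b :: "'n \<Rightarrow> real^'n"
  assumes sym: "transpose S = S" and orth: "\<And>i j. b i \<bullet> b j = (if i = j then 1 else 0)"
    and eig: "\<And>i. S *v b i = \<mu> i *\<^sub>R b i" and pos: "\<And>i. \<mu> i > 0"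
    and q: "\<mu> q \<le> \<mu> p" "\<And>i. i \<noteq> p \<Longrightarrow> \<mu> i \<le> \<mu> q"
    and frame: "e \<bullet> e = 1" "u \<bullet> u = 1" "e \<bullet> u = 0" "u \<bullet> b p = 0"
      "v = (v \<bullet> e) *\<^sub>R e + (v \<bullet> u) *\<^sub>R u"
    and v: "v \<in> ellipsoid S r"
  shows "vector [v \<bullet> e, v \<bullet> u] \<in> ellipse (\<mu> p) (\<mu> q) r"
proof -
  define \<alpha> \<beta> \<kappa> where "\<alpha> = v \<bullet> e" and "\<beta> = v \<bullet> u" and "\<kappa> = e \<bullet> b p"
  have vb: "v \<bullet> b p = \<alpha> * \<kappa>"
    by (subst frame(5)) (simp add: inner_simps frame(4) \<alpha>_def \<kappa>_def)
  have vv: "v \<bullet> v = \<alpha>\<^sup>2 + \<beta>\<^sup>2"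
    by (subst frame(5)) (simp add: inner_simps inner_commute \<alpha>_def \<beta>_def power2_eq_square)
  have "\<bar>\<kappa>\<bar> \<le> norm e * norm (b p)" unfolding \<kappa>_def by (rule Cauchy_Schwarz_ineq2)
  also have "\<dots> = 1" using frame(1) orth[of p p] by (simp add: norm_eq_sqrt_inner)
  finally have \<kappa>: "0 \<le> \<alpha>\<^sup>2 * (1 - \<kappa>\<^sup>2)" by (simp add: abs_square_le_1)
  have parseval: "v \<bullet> v = (\<Sum>i\<in>UNIV. (v \<bullet> b i)\<^sup>2)"
  proof -
    have "v \<bullet> v = v \<bullet> (\<Sum>i\<in>UNIV. (v \<bullet> b i) *\<^sub>R b i)"
      by (simp only: orthonormal_expansion[OF orth])
    then show ?thesis by (simp add: inner_sum_right power2_eq_square)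
  qed
  have "\<alpha>\<^sup>2 / \<mu> p + \<beta>\<^sup>2 / \<mu> q
      = (\<alpha> * \<kappa>)\<^sup>2 / \<mu> p + \<alpha>\<^sup>2 * (1 - \<kappa>\<^sup>2) / \<mu> p + \<beta>\<^sup>2 / \<mu> q"
    by (simp add: power_mult_distrib algebra_simps diff_divide_distrib)
  also have "\<dots> \<le> (\<alpha> * \<kappa>)\<^sup>2 / \<mu> p + \<alpha>\<^sup>2 * (1 - \<kappa>\<^sup>2) / \<mu> q + \<beta>\<^sup>2 / \<mu> q"
    using q(1) pos[of q] \<kappa> by (simp add: divide_left_mono)
  also have "\<dots> = (v \<bullet> b p)\<^sup>2 / \<mu> p + (v \<bullet> v - (v \<bullet> b p)\<^sup>2) / \<mu> q"
    by (simp add: vb vv power_mult_distrib algebra_simps diff_divide_distrib add_divide_distrib)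
  also have "v \<bullet> v - (v \<bullet> b p)\<^sup>2 = (\<Sum>i\<in>UNIV - {p}. (v \<bullet> b i)\<^sup>2)"
    unfolding parseval by (simp add: sum_diff1)
  also have "(v \<bullet> b p)\<^sup>2 / \<mu> p + (\<Sum>i\<in>UNIV - {p}. (v \<bullet> b i)\<^sup>2) / \<mu> q
      \<le> (v \<bullet> b p)\<^sup>2 / \<mu> p + (\<Sum>i\<in>UNIV - {p}. (v \<bullet> b i)\<^sup>2 / \<mu> i)"
    unfolding sum_divide_distrib
    by (intro add_left_mono sum_mono divide_left_mono) (auto intro: q pos mult_pos_pos)
  also have "\<dots> = (\<Sum>i\<in>UNIV. (v \<bullet> b i)\<^sup>2 / \<mu> i)"
    by (simp add: sum.remove[of UNIV p])
  also have "\<dots> \<le> r\<^sup>2"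
    using v inner_matrix_inv_eigenbasis[OF sym orth eig pos] by (simp add: ellipsoid_def)
  finally show ?thesis by (simp add: ellipse_def \<alpha>_def \<beta>_def)
qed

section \<open>Square-integrable functions and mean-square derivatives\<close>

definition square_integrable :: "'a measure \<Rightarrow> ('a \<Rightarrow> real) set" where
  "square_integrable M = {X \<in> borel_measurable M. integrable M (\<lambda>\<omega>. (X \<omega>)\<^sup>2)}"

lemma square_integrable_measurable:
  "X \<in> square_integrable M \<Longrightarrow> X \<in> borel_measurable M"
  by (simp add: square_integrable_def)

lemma integrable_mult_square_integrable:
  assumes "X \<in> square_integrable M" "Y \<in> square_integrable M"
  shows "integrable M (\<lambda>\<omega>. X \<omega> * Y \<omega>)"
proof (rule Bochner_Integration.integrable_bound)
  show "integrable M (\<lambda>\<omega>. (X \<omega>)\<^sup>2 + (Y \<omega>)\<^sup>2)"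
    using assms by (simp add: square_integrable_def)
  show "(\<lambda>\<omega>. X \<omega> * Y \<omega>) \<in> borel_measurable M"
    using assms by (auto simp: square_integrable_def)
  have "\<bar>X \<omega> * Y \<omega>\<bar> \<le> (X \<omega>)\<^sup>2 + (Y \<omega>)\<^sup>2" for \<omega>
  proof -
    have "2 * \<bar>X \<omega>\<bar> * \<bar>Y \<omega>\<bar> \<le> (X \<omega>)\<^sup>2 + (Y \<omega>)\<^sup>2"
      using sum_squares_bound[of "\<bar>X \<omega>\<bar>" "\<bar>Y \<omega>\<bar>"] by simp
    moreover have "0 \<le> \<bar>X \<omega>\<bar> * \<bar>Y \<omega>\<bar>" by simp
    ultimately show ?thesis unfolding abs_mult by linarith
  qed
  then show "AE \<omega> in M. norm (X \<omega> * Y \<omega>) \<le> norm ((X \<omega>)\<^sup>2 + (Y \<omega>)\<^sup>2)" by simp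
qed

lemma square_integrable_add:
  assumes "X \<in> square_integrable M" "Y \<in> square_integrable M"
  shows "(\<lambda>\<omega>. X \<omega> + Y \<omega>) \<in> square_integrable M"
  using assms integrable_mult_square_integrable[OF assms]
  by (auto simp: square_integrable_def power2_sum mult.assoc)

lemma square_integrable_cmult:
  assumes "X \<in> square_integrable M"
  shows "(\<lambda>\<omega>. c * X \<omega>) \<in> square_integrable M"
  using assms by (auto simp: square_integrable_def power_mult_distrib)

lemma square_integrable_diff:
  assumes "X \<in> square_integrable M" "Y \<in> square_integrable M"
  shows "(\<lambda>\<omega>. X \<omega> - Y \<omega>) \<in> square_integrable M"
  using square_integrable_add[OF assms(1) square_integrable_cmult[OF assms(2), of "-1"]] by simp

lemma square_integrable_divide:
  assumes "X \<in> square_integrable M"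
  shows "(\<lambda>\<omega>. X \<omega> / c) \<in> square_integrable M"
  using square_integrable_cmult[OF assms, of "1 / c"] by simp

lemma square_integrable_sum:
  assumes "\<And>i. i \<in> I \<Longrightarrow> X i \<in> square_integrable M"
  shows "(\<lambda>\<omega>. \<Sum>i\<in>I. X i \<omega>) \<in> square_integrable M"
  using assms
proof (induction I rule: infinite_finite_induct)
  case (insert i I)
  then show ?case by (simp add: square_integrable_add)
qed (simp_all add: square_integrable_def)

lemma integral_square_nonneg:
  fixes X :: "'a \<Rightarrow> real"
  shows "0 \<le> (\<integral>\<omega>. X \<omega> * X \<omega> \<partial>M)"
  by (rule Bochner_Integration.integral_nonneg) simp

lemma Cauchy_Schwarz_integral:
  assumes X: "X \<in> square_integrable M" and Y: "Y \<in> square_integrable M"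
  shows "\<bar>\<integral>\<omega>. X \<omega> * Y \<omega> \<partial>M\<bar> \<le> sqrt (\<integral>\<omega>. X \<omega> * X \<omega> \<partial>M) * sqrt (\<integral>\<omega>. Y \<omega> * Y \<omega> \<partial>M)"
proof -
  define a b c where "a = (\<integral>\<omega>. X \<omega> * X \<omega> \<partial>M)" and "b = (\<integral>\<omega>. Y \<omega> * Y \<omega> \<partial>M)"
    and "c = (\<integral>\<omega>. X \<omega> * Y \<omega> \<partial>M)"
  note int = integrable_mult_square_integrable[OF X X] integrable_mult_square_integrable[OF X Y]
    integrable_mult_square_integrable[OF Y Y]
  have quad: "0 \<le> a - 2 * t * c + t\<^sup>2 * b" for t
  proof -
    have "0 \<le> (\<integral>\<omega>. (X \<omega> - t * Y \<omega>) * (X \<omega> - t * Y \<omega>) \<partial>M)"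
      by (rule integral_square_nonneg)
    also have "\<dots> = (\<integral>\<omega>. X \<omega> * X \<omega> - 2 * t * (X \<omega> * Y \<omega>) + t\<^sup>2 * (Y \<omega> * Y \<omega>) \<partial>M)"
      by (intro Bochner_Integration.integral_cong) (simp_all add: algebra_simps power2_eq_square)
    also have "\<dots> = a - 2 * t * c + t\<^sup>2 * b"
      using int by (simp add: a_def b_def c_def)
    finally show ?thesis .
  qed
  have nn: "0 \<le> a" "0 \<le> b"
    by (simp_all add: a_def b_def)
  have "c\<^sup>2 \<le> a * b"
  proof (cases "b = 0")
    case True
    have "c = 0"
    proof (rule ccontr)
      assume "c \<noteq> 0"
      \<comment> \<open>This \<open>t\<close> gives the quadratic the value \<open>-1\<close>.\<close>
      then show False using quad[of "(a + 1) / (2 * c)"] True by simp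
    qed
    then show ?thesis using True by simp
  next
    case False
    \<comment> \<open>The minimiser of the quadratic.\<close>
    then show ?thesis using quad[of "c / b"] nn
      by (simp add: field_simps power2_eq_square)
  qed
  then have "sqrt (c\<^sup>2) \<le> sqrt (a * b)" by (rule real_sqrt_le_mono)
  then show ?thesis
    by (simp add: a_def b_def c_def real_sqrt_mult)
qed

text \<open>
  The \<open>L\<^sup>2\<close> inner product is continuous: with errors \<open>A = X - U\<close> and \<open>B = Y - V\<close>, the difference of
  the two sides is the integral of \<open>A * B + U * B + A * V\<close>, and Cauchy--Schwarz applies to each term.
\<close>

lemma tendsto_integral_mult_of_L2:
  fixes X Y :: "'b \<Rightarrow> 'a \<Rightarrow> real"
  assumes X: "\<forall>\<^sub>F \<epsilon> in F. X \<epsilon> \<in> square_integrable M" and Y: "\<forall>\<^sub>F \<epsilon> in F. Y \<epsilon> \<in> square_integrable M"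
    and U: "U \<in> square_integrable M" and V: "V \<in> square_integrable M"
    and XU: "((\<lambda>\<epsilon>. \<integral>\<omega>. (X \<epsilon> \<omega> - U \<omega>) * (X \<epsilon> \<omega> - U \<omega>) \<partial>M) \<longlongrightarrow> 0) F"
    and YV: "((\<lambda>\<epsilon>. \<integral>\<omega>. (Y \<epsilon> \<omega> - V \<omega>) * (Y \<epsilon> \<omega> - V \<omega>) \<partial>M) \<longlongrightarrow> 0) F"
  shows "((\<lambda>\<epsilon>. \<integral>\<omega>. X \<epsilon> \<omega> * Y \<epsilon> \<omega> \<partial>M) \<longlongrightarrow> (\<integral>\<omega>. U \<omega> * V \<omega> \<partial>M)) F"
proof -
  define nrm where "nrm Z = sqrt (\<integral>\<omega>. Z \<omega> * Z \<omega> \<partial>M)" for Z :: "'a \<Rightarrow> real"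
  define A B where "A \<epsilon> = (\<lambda>\<omega>. X \<epsilon> \<omega> - U \<omega>)" and "B \<epsilon> = (\<lambda>\<omega>. Y \<epsilon> \<omega> - V \<omega>)" for \<epsilon>
  have bound: "norm ((\<integral>\<omega>. X \<epsilon> \<omega> * Y \<epsilon> \<omega> \<partial>M) - (\<integral>\<omega>. U \<omega> * V \<omega> \<partial>M))
      \<le> nrm (A \<epsilon>) * nrm (B \<epsilon>) + nrm U * nrm (B \<epsilon>) + nrm (A \<epsilon>) * nrm V"
    if "X \<epsilon> \<in> square_integrable M" "Y \<epsilon> \<in> square_integrable M" for \<epsilon>
  proof -
    have A: "A \<epsilon> \<in> square_integrable M" and B: "B \<epsilon> \<in> square_integrable M"
      using that U V by (auto simp: A_def B_def intro: square_integrable_diff)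
    note int = integrable_mult_square_integrable
    have "(\<integral>\<omega>. X \<epsilon> \<omega> * Y \<epsilon> \<omega> \<partial>M)
        = (\<integral>\<omega>. A \<epsilon> \<omega> * B \<epsilon> \<omega> + U \<omega> * B \<epsilon> \<omega> + A \<epsilon> \<omega> * V \<omega> + U \<omega> * V \<omega> \<partial>M)"
      by (intro Bochner_Integration.integral_cong) (simp_all add: A_def B_def algebra_simps)
    also have "\<dots> = (\<integral>\<omega>. A \<epsilon> \<omega> * B \<epsilon> \<omega> \<partial>M) + (\<integral>\<omega>. U \<omega> * B \<epsilon> \<omega> \<partial>M)
        + (\<integral>\<omega>. A \<epsilon> \<omega> * V \<omega> \<partial>M) + (\<integral>\<omega>. U \<omega> * V \<omega> \<partial>M)"
      using int[OF A B] int[OF U B] int[OF A V] int[OF U V] by simp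
    finally show ?thesis
      using Cauchy_Schwarz_integral[OF A B] Cauchy_Schwarz_integral[OF U B]
        Cauchy_Schwarz_integral[OF A V] by (simp add: nrm_def)
  qed
  have A0: "((\<lambda>\<epsilon>. nrm (A \<epsilon>)) \<longlongrightarrow> 0) F" and B0: "((\<lambda>\<epsilon>. nrm (B \<epsilon>)) \<longlongrightarrow> 0) F"
    using tendsto_real_sqrt[OF XU] tendsto_real_sqrt[OF YV] by (simp_all add: nrm_def A_def B_def)
  have "((\<lambda>\<epsilon>. nrm (A \<epsilon>) * nrm (B \<epsilon>) + nrm U * nrm (B \<epsilon>) + nrm (A \<epsilon>) * nrm V)
      \<longlongrightarrow> 0 * 0 + nrm U * 0 + 0 * nrm V) F"
    by (intro tendsto_intros A0 B0)
  then have lim0: "((\<lambda>\<epsilon>. nrm (A \<epsilon>) * nrm (B \<epsilon>) + nrm U * nrm (B \<epsilon>) + nrm (A \<epsilon>) * nrm V)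
      \<longlongrightarrow> 0) F" by simp
  have "((\<lambda>\<epsilon>. (\<integral>\<omega>. X \<epsilon> \<omega> * Y \<epsilon> \<omega> \<partial>M) - (\<integral>\<omega>. U \<omega> * V \<omega> \<partial>M)) \<longlongrightarrow> 0) F"
    using lim0
    by (rule Lim_null_comparison[rotated]) (use X Y bound in \<open>auto elim: eventually_elim2\<close>)
  then show ?thesis by (simp add: LIM_zero_iff)
qed

text \<open>
  A mean-square derivative is defined by a nonnegative integral tending to \<open>0\<close>. The integral is
  therefore eventually finite, so \<open>U\<close> differs from some square-integrable quotient by a
  square-integrable function. The second claim restates the limit for the Bochner integral.
\<close>

lemma ms_derivative_square_integrable:
  assumes g: "\<And>y. g y \<in> square_integrable M" and d: "has_ms_derivative M g e x U"
  shows "U \<in> square_integrable M"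
    and "((\<lambda>\<epsilon>. \<integral>\<omega>. ((g (x + \<epsilon> *\<^sub>R e) \<omega> - g x \<omega>) / \<epsilon> - U \<omega>)
            * ((g (x + \<epsilon> *\<^sub>R e) \<omega> - g x \<omega>) / \<epsilon> - U \<omega>) \<partial>M) \<longlongrightarrow> 0) (at 0)"
proof -
  define Q where "Q \<epsilon> = (\<lambda>\<omega>. (g (x + \<epsilon> *\<^sub>R e) \<omega> - g x \<omega>) / \<epsilon>)" for \<epsilon>
  define N where "N \<epsilon> = (\<integral>\<^sup>+\<omega>. ennreal ((Q \<epsilon> \<omega> - U \<omega>)\<^sup>2) \<partial>M)" for \<epsilon>
  have Q: "Q \<epsilon> \<in> square_integrable M" for \<epsilon>
    unfolding Q_def by (intro square_integrable_divide square_integrable_diff g)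
  have U[measurable]: "U \<in> borel_measurable M" and N0: "(N \<longlongrightarrow> 0) (at 0)"
    using d by (simp_all add: has_ms_derivative_def N_def[abs_def] Q_def)
  have [measurable]: "Q \<epsilon> \<in> borel_measurable M" for \<epsilon>
    using Q by (rule square_integrable_measurable)
  have fin: "(\<lambda>\<omega>. Q \<epsilon> \<omega> - U \<omega>) \<in> square_integrable M" if "N \<epsilon> < 1" for \<epsilon>
  proof -
    have "N \<epsilon> < \<infinity>" using that by (simp add: order.strict_trans ennreal_one_less_top)
    then have "integrable M (\<lambda>\<omega>. (Q \<epsilon> \<omega> - U \<omega>)\<^sup>2)"
      by (intro integrableI_nonneg) (simp_all add: N_def)
    then show ?thesis by (simp add: square_integrable_def)
  qed
  have ev: "\<forall>\<^sub>F \<epsilon> in at 0. N \<epsilon> < 1"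
    using N0 by (rule order_tendstoD) simp
  then obtain \<epsilon> where "N \<epsilon> < 1"
    using eventually_happens'[OF at_neq_bot] by blast
  from square_integrable_diff[OF Q[of \<epsilon>] fin[OF this]] show "U \<in> square_integrable M"
    by simp
  have "((\<lambda>\<epsilon>. enn2real (N \<epsilon>)) \<longlongrightarrow> enn2real 0) (at 0)"
    using N0 by (intro tendsto_enn2real) simp_all
  moreover have "enn2real (N \<epsilon>) = (\<integral>\<omega>. (Q \<epsilon> \<omega> - U \<omega>) * (Q \<epsilon> \<omega> - U \<omega>) \<partial>M)" for \<epsilon>
    unfolding N_def power2_eq_square[symmetric]
    by (subst integral_eq_nn_integral) simp_all
  ultimately show "((\<lambda>\<epsilon>. \<integral>\<omega>. ((g (x + \<epsilon> *\<^sub>R e) \<omega> - g x \<omega>) / \<epsilon> - U \<omega>)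
            * ((g (x + \<epsilon> *\<^sub>R e) \<omega> - g x \<omega>) / \<epsilon> - U \<omega>) \<partial>M) \<longlongrightarrow> 0) (at 0)"
    by (simp add: Q_def)
qed

text \<open>
  The diagonal limit: both difference quotients use the same increment \<open>\<epsilon>\<close>.
\<close>

lemma tendsto_integral_ms_quotients:
  assumes g: "\<And>y. g y \<in> square_integrable M" and d: "has_ms_derivative M g e x U"
    and g': "\<And>y. g' y \<in> square_integrable M" and d': "has_ms_derivative M g' e' x' U'"
  shows "((\<lambda>\<epsilon>. ((\<integral>\<omega>. g (x + \<epsilon> *\<^sub>R e) \<omega> * g' (x' + \<epsilon> *\<^sub>R e') \<omega> \<partial>M) - (\<integral>\<omega>. g x \<omega> * g' (x' + \<epsilon> *\<^sub>R e') \<omega> \<partial>M)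
      - (\<integral>\<omega>. g (x + \<epsilon> *\<^sub>R e) \<omega> * g' x' \<omega> \<partial>M) + (\<integral>\<omega>. g x \<omega> * g' x' \<omega> \<partial>M)) / \<epsilon>\<^sup>2)
    \<longlongrightarrow> (\<integral>\<omega>. U \<omega> * U' \<omega> \<partial>M)) (at 0)"
proof -
  note int = integrable_mult_square_integrable[OF g g']
  have "((\<lambda>\<epsilon>. \<integral>\<omega>. ((g (x + \<epsilon> *\<^sub>R e) \<omega> - g x \<omega>) / \<epsilon>) * ((g' (x' + \<epsilon> *\<^sub>R e') \<omega> - g' x' \<omega>) / \<epsilon>) \<partial>M)
    \<longlongrightarrow> (\<integral>\<omega>. U \<omega> * U' \<omega> \<partial>M)) (at 0)"
    by (intro tendsto_integral_mult_of_L2 always_eventually allI square_integrable_divide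
        square_integrable_diff g g' ms_derivative_square_integrable[OF g d]
        ms_derivative_square_integrable[OF g' d'])
  moreover have "(\<integral>\<omega>. ((g (x + \<epsilon> *\<^sub>R e) \<omega> - g x \<omega>) / \<epsilon>) * ((g' (x' + \<epsilon> *\<^sub>R e') \<omega> - g' x' \<omega>) / \<epsilon>) \<partial>M)
    = ((\<integral>\<omega>. g (x + \<epsilon> *\<^sub>R e) \<omega> * g' (x' + \<epsilon> *\<^sub>R e') \<omega> \<partial>M) - (\<integral>\<omega>. g x \<omega> * g' (x' + \<epsilon> *\<^sub>R e') \<omega> \<partial>M)
      - (\<integral>\<omega>. g (x + \<epsilon> *\<^sub>R e) \<omega> * g' x' \<omega> \<partial>M) + (\<integral>\<omega>. g x \<omega> * g' x' \<omega> \<partial>M)) / \<epsilon>\<^sup>2" for \<epsilon>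
  proof -
    have "(\<integral>\<omega>. ((g (x + \<epsilon> *\<^sub>R e) \<omega> - g x \<omega>) / \<epsilon>) * ((g' (x' + \<epsilon> *\<^sub>R e') \<omega> - g' x' \<omega>) / \<epsilon>) \<partial>M)
      = (\<integral>\<omega>. (g (x + \<epsilon> *\<^sub>R e) \<omega> * g' (x' + \<epsilon> *\<^sub>R e') \<omega> - g x \<omega> * g' (x' + \<epsilon> *\<^sub>R e') \<omega>
      - g (x + \<epsilon> *\<^sub>R e) \<omega> * g' x' \<omega> + g x \<omega> * g' x' \<omega>) / \<epsilon>\<^sup>2 \<partial>M)"
      by (intro Bochner_Integration.integral_cong refl)
        (simp add: algebra_simps power2_eq_square add_divide_distrib diff_divide_distrib)
    then show ?thesis using int by simp
  qed
  ultimately show ?thesis by simp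
qed

lemma has_real_derivative_integral_ms:
  assumes g: "\<And>y. g y \<in> square_integrable M" and d: "has_ms_derivative M g e x U"
    and Y: "Y \<in> square_integrable M"
  shows "((\<lambda>\<epsilon>. \<integral>\<omega>. Y \<omega> * g (x + \<epsilon> *\<^sub>R e) \<omega> \<partial>M) has_real_derivative (\<integral>\<omega>. Y \<omega> * U \<omega> \<partial>M)) (at 0)"
proof -
  note int = integrable_mult_square_integrable[OF Y g]
  have "((\<lambda>\<epsilon>. \<integral>\<omega>. Y \<omega> * ((g (x + \<epsilon> *\<^sub>R e) \<omega> - g x \<omega>) / \<epsilon>) \<partial>M)
    \<longlongrightarrow> (\<integral>\<omega>. Y \<omega> * U \<omega> \<partial>M)) (at 0)"
    by (intro tendsto_integral_mult_of_L2 always_eventually allI square_integrable_divide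
        square_integrable_diff g Y ms_derivative_square_integrable[OF g d]) simp
  moreover have "(\<integral>\<omega>. Y \<omega> * ((g (x + \<epsilon> *\<^sub>R e) \<omega> - g x \<omega>) / \<epsilon>) \<partial>M)
      = ((\<integral>\<omega>. Y \<omega> * g (x + \<epsilon> *\<^sub>R e) \<omega> \<partial>M) - (\<integral>\<omega>. Y \<omega> * g x \<omega> \<partial>M)) / \<epsilon>" for \<epsilon>
    using int by (simp add: right_diff_distrib)
  ultimately show ?thesis
    by (simp only: has_field_derivative_iff diff_zero scaleR_zero_left add_0_right)
qed

text \<open>
  A nondegenerate normal density is integrated against \<open>x\<^sup>2 = (x - \<mu>)\<^sup>2 + 2 * \<mu> * x - \<mu>\<^sup>2\<close>, whose terms
  have known moments; a degenerate law is almost surely constant.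
\<close>

lemma gaussian_rv_square_integrable:
  assumes "prob_space M" "gaussian_rv M X"
  shows "X \<in> square_integrable M"
proof -
  have [measurable]: "X \<in> borel_measurable M" using assms(2) by (simp add: gaussian_rv_def)
  consider \<mu> \<sigma> where "\<sigma> > 0" "distributed M lborel X (\<lambda>x. ennreal (normal_density \<mu> \<sigma> x))"
    | \<mu> where "AE \<omega> in M. X \<omega> = \<mu>"
    using assms(2) by (auto simp: gaussian_rv_def)
  then have "integrable M (\<lambda>\<omega>. (X \<omega>)\<^sup>2)"
  proof cases
    case 1
    have "integrable lborel (\<lambda>x. normal_density \<mu> \<sigma> x * (x - \<mu>)^2
        + 2 * \<mu> * (normal_density \<mu> \<sigma> x * x) - \<mu>\<^sup>2 * normal_density \<mu> \<sigma> x)"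
      using 1(1) integrable_normal_moment[of \<sigma> \<mu> 2] integrable_normal_moment_nz_1[of \<sigma> \<mu>]
      by (intro Bochner_Integration.integrable_add Bochner_Integration.integrable_diff) simp_all
    moreover have "normal_density \<mu> \<sigma> x * (x - \<mu>)^2 + 2 * \<mu> * (normal_density \<mu> \<sigma> x * x)
        - \<mu>\<^sup>2 * normal_density \<mu> \<sigma> x = normal_density \<mu> \<sigma> x * x\<^sup>2" for x
      by (simp add: power2_eq_square algebra_simps)
    ultimately have "integrable lborel (\<lambda>x. normal_density \<mu> \<sigma> x * x\<^sup>2)" by simp
    with distributed_integrable[OF 1(2), of "\<lambda>x. x\<^sup>2"] show ?thesis by simp
  next
    case 2
    have "integrable M (\<lambda>\<omega>. \<mu>\<^sup>2)"
      by (rule finite_measure.integrable_const[OF prob_space.finite_measure[OF assms(1)]])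
    moreover have "AE \<omega> in M. \<mu>\<^sup>2 = (X \<omega>)\<^sup>2" using 2 by auto
    ultimately show ?thesis
      by (subst integrable_cong_AE[of _ _ "\<lambda>\<omega>. \<mu>\<^sup>2"]) auto
  qed
  then show ?thesis by (simp add: square_integrable_def)
qed

section \<open>Sums over a basis and the flip of coordinates\<close>

text \<open>
  Contracting the coordinates of \<open>a\<close> with a linear form evaluates the form at \<open>a\<close>. The moments
  of the gradient and Hessian terms of the Taylor polynomial are evaluated in this way, without
  handling single basis vectors.
\<close>

lemma sum_Basis_linear:
  fixes L :: "'x::euclidean_space \<Rightarrow> real"
  assumes "linear L"
  shows "(\<Sum>i\<in>Basis. (a \<bullet> i) * L i) = L a"
proof -
  have "L a = L (\<Sum>i\<in>Basis. (a \<bullet> i) *\<^sub>R i)" by (simp add: euclidean_representation)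
  also have "\<dots> = (\<Sum>i\<in>Basis. (a \<bullet> i) * L i)"
    by (simp add: linear_sum[OF assms] linear_scale[OF assms])
  finally show ?thesis by simp
qed

lemma sum_Basis_bilinear:
  fixes L :: "'x::euclidean_space \<Rightarrow> 'x \<Rightarrow> real"
  assumes "\<And>i. linear (L i)" "\<And>j. linear (\<lambda>i. L i j)"
  shows "(\<Sum>i\<in>Basis. \<Sum>j\<in>Basis. (a \<bullet> i) * (a \<bullet> j) * L i j) = L a a"
proof -
  have "(\<Sum>i\<in>Basis. \<Sum>j\<in>Basis. (a \<bullet> i) * (a \<bullet> j) * L i j)
      = (\<Sum>i\<in>Basis. (a \<bullet> i) * (\<Sum>j\<in>Basis. (a \<bullet> j) * L i j))"
    by (simp add: sum_distrib_left mult.assoc)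
  then show ?thesis
    using sum_Basis_linear[OF assms(1)] sum_Basis_linear[OF assms(2)] by simp
qed

lemma inner_swap: "prod.swap a \<bullet> prod.swap b = a \<bullet> b"
  by (simp add: inner_prod_def)

lemma inner_swap_left: "prod.swap a \<bullet> b = a \<bullet> prod.swap b"
  by (simp add: inner_prod_def)

lemma swap_add: "prod.swap (a + b) = prod.swap a + prod.swap b"
  by (simp add: plus_prod_def prod.swap_def)

lemma swap_diff: "prod.swap (a - b) = prod.swap a - prod.swap b"
  by (simp add: minus_prod_def prod.swap_def)

lemma swap_scaleR: "prod.swap (c *\<^sub>R a) = c *\<^sub>R prod.swap a"
  by (simp add: scaleR_prod_def prod.swap_def)

lemma swap_minus: "prod.swap (- a) = - prod.swap a"
  by (simp add: uminus_prod_def prod.swap_def)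

lemma norm_swap:
  fixes a :: "'x::real_inner \<times> 'x"
  shows "norm (prod.swap a) = norm a"
  by (simp add: norm_eq_sqrt_inner inner_swap)

lemmas swap_linear_simps = swap_add swap_diff swap_scaleR swap_minus inner_swap_left inner_simps

section \<open>Derivatives of an isotropic covariance kernel\<close>

text \<open>
  The first derivative of \<open>h ((norm (x - y))\<^sup>2)\<close> with respect to \<open>y\<close> in direction \<open>a\<close>,
  as a function of \<open>t = x - y\<close>.
\<close>

definition grad_kernel :: "(real \<Rightarrow> real) \<Rightarrow> 'x::real_inner \<Rightarrow> 'x \<Rightarrow> real" where
  "grad_kernel h' a t = - 2 * h' ((norm t)\<^sup>2) * (t \<bullet> a)"

text \<open>
  The mixed derivative of \<open>h ((norm (x - y))\<^sup>2)\<close>, once in \<open>x\<close> in direction \<open>a\<close> and once in \<open>y\<close> in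
  direction \<open>b\<close>, as a function of \<open>t = x - y\<close>. It is the covariance of two directional derivatives of
  a field with this covariance.
\<close>

definition grad_cov :: "(real \<Rightarrow> real) \<Rightarrow> (real \<Rightarrow> real) \<Rightarrow> 'x::real_inner \<Rightarrow> 'x \<Rightarrow> 'x \<Rightarrow> real" where
  "grad_cov h' h'' a b t =
     - 4 * h'' ((norm t)\<^sup>2) * (t \<bullet> a) * (t \<bullet> b) - 2 * h' ((norm t)\<^sup>2) * (a \<bullet> b)"

text \<open>
  At the origin \<open>k\<close> is only differentiable from the right. The chain rule still applies, because the
  squared norm takes values in the half-line.
\<close>

lemma C2_halfline_radial_derivative:
  fixes t s :: "'x::real_inner"
  assumes "\<And>y. y \<ge> 0 \<Longrightarrow> (k has_real_derivative k' y) (at y within {0..})"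
  shows "((\<lambda>\<epsilon>. k ((norm (t + \<epsilon> *\<^sub>R s))\<^sup>2)) has_real_derivative (k' ((norm t)\<^sup>2) * (2 * (t \<bullet> s)))) (at 0)"
proof -
  define g where "g \<epsilon> = (norm (t + \<epsilon> *\<^sub>R s))\<^sup>2" for \<epsilon> :: real
  have g_eq: "g \<epsilon> = (norm t)\<^sup>2 + 2 * \<epsilon> * (t \<bullet> s) + \<epsilon>\<^sup>2 * (norm s)\<^sup>2" for \<epsilon>
    unfolding g_def power2_norm_eq_inner
    by (simp add: inner_simps inner_commute algebra_simps power2_eq_square)
  have "(g has_real_derivative (2 * (t \<bullet> s))) (at 0)"
    unfolding g_eq[abs_def] by (auto intro!: derivative_eq_intros)
  moreover have "(k has_real_derivative k' ((norm t)\<^sup>2)) (at (g 0) within range g)"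
    using assms[of "(norm t)\<^sup>2"] by (rule_tac has_field_derivative_subset) (auto simp: g_def)
  ultimately show ?thesis
    using DERIV_image_chain[of k _ g 0 UNIV] by (simp add: o_def g_def)
qed

context
  fixes h h' h'' :: "real \<Rightarrow> real"
  assumes C2: "C2_halfline h h' h''"
begin

lemma covariance_radial_derivative:
  fixes t s :: "'x::real_inner"
  shows "((\<lambda>\<epsilon>. h ((norm (t - \<epsilon> *\<^sub>R s))\<^sup>2)) has_real_derivative grad_kernel h' s t) (at 0)"
  using C2_halfline_radial_derivative[of h h' t "- s"] C2
  by (auto simp: C2_halfline_def grad_kernel_def algebra_simps)

lemma grad_kernel_derivative:
  fixes t s a :: "'x::real_inner"
  shows "((\<lambda>\<epsilon>. grad_kernel h' a (t + \<epsilon> *\<^sub>R s)) has_real_derivative grad_cov h' h'' s a t) (at 0)"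
proof -
  have d: "((\<lambda>\<epsilon>. h' ((norm (t + \<epsilon> *\<^sub>R s))\<^sup>2)) has_real_derivative h'' ((norm t)\<^sup>2) * (2 * (t \<bullet> s))) (at 0)"
    using C2 by (intro C2_halfline_radial_derivative) (auto simp: C2_halfline_def)
  have l: "((\<lambda>\<epsilon>. (t + \<epsilon> *\<^sub>R s) \<bullet> a) has_real_derivative s \<bullet> a) (at 0)"
    unfolding inner_simps by (auto intro!: derivative_eq_intros)
  from DERIV_mult[OF DERIV_cmult[OF d, of "-2"] l] show ?thesis
    unfolding grad_kernel_def grad_cov_def by (rule DERIV_cong) (simp add: algebra_simps)
qed

text \<open>
  With \<open>q = \<epsilon>\<^sup>2 * (norm s)\<^sup>2\<close>, the \<open>h''\<close> term of \<open>grad_cov\<close> already carries a factor \<open>\<epsilon>\<^sup>2\<close>, so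
  continuity of \<open>h''\<close> at \<open>0\<close> is enough for it. The increment of \<open>h'\<close> is divided by \<open>q\<close>, which tends
  to \<open>0\<close> from the right.
\<close>

lemma grad_cov_second_difference:
  fixes a b s :: "'x::real_inner"
  shows "((\<lambda>\<epsilon>. (grad_cov h' h'' a b (\<epsilon> *\<^sub>R s) - grad_cov h' h'' a b 0) / \<epsilon>\<^sup>2)
    \<longlongrightarrow> - 4 * h'' 0 * (s \<bullet> a) * (s \<bullet> b) - 2 * h'' 0 * (norm s)\<^sup>2 * (a \<bullet> b)) (at 0)"
proof (cases "s = 0")
  case True
  then show ?thesis by simp
next
  case False
  define q where "q \<epsilon> = \<epsilon>\<^sup>2 * (norm s)\<^sup>2" for \<epsilon> :: real
  have q: "filterlim q (at 0 within {0..}) (at 0)"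
    unfolding filterlim_at
  proof
    show "\<forall>\<^sub>F \<epsilon> in at 0. q \<epsilon> \<in> {0..} \<and> q \<epsilon> \<noteq> 0"
      unfolding q_def using False by (auto simp: eventually_at_filter)
    have "(q \<longlongrightarrow> 0\<^sup>2 * (norm s)\<^sup>2) (at 0)" unfolding q_def by (intro tendsto_intros)
    then show "(q \<longlongrightarrow> 0) (at 0)" by simp
  qed
  have "(h'' \<longlongrightarrow> h'' 0) (at 0 within {0..})"
    using C2 by (auto simp: C2_halfline_def continuous_on_def)
  from filterlim_compose[OF this q] have A: "((\<lambda>\<epsilon>. h'' (q \<epsilon>)) \<longlongrightarrow> h'' 0) (at 0)" .
  have "((\<lambda>y. (h' y - h' 0) / y) \<longlongrightarrow> h'' 0) (at 0 within {0..})"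
    using C2 by (auto simp: C2_halfline_def has_field_derivative_iff)
  from filterlim_compose[OF this q]
  have B: "((\<lambda>\<epsilon>. (h' (q \<epsilon>) - h' 0) / q \<epsilon>) \<longlongrightarrow> h'' 0) (at 0)" .
  have "((\<lambda>\<epsilon>. - 4 * h'' (q \<epsilon>) * (s \<bullet> a) * (s \<bullet> b)
      - 2 * ((h' (q \<epsilon>) - h' 0) / q \<epsilon>) * (norm s)\<^sup>2 * (a \<bullet> b))
    \<longlongrightarrow> - 4 * h'' 0 * (s \<bullet> a) * (s \<bullet> b) - 2 * h'' 0 * (norm s)\<^sup>2 * (a \<bullet> b)) (at 0)"
    by (intro tendsto_intros A B)
  moreover have "\<forall>\<^sub>F \<epsilon> in at 0. - 4 * h'' (q \<epsilon>) * (s \<bullet> a) * (s \<bullet> b)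
      - 2 * ((h' (q \<epsilon>) - h' 0) / q \<epsilon>) * (norm s)\<^sup>2 * (a \<bullet> b)
      = (grad_cov h' h'' a b (\<epsilon> *\<^sub>R s) - grad_cov h' h'' a b 0) / \<epsilon>\<^sup>2"
    unfolding eventually_at_filter
  proof (intro always_eventually allI impI)
    fix \<epsilon> :: real assume "\<epsilon> \<noteq> 0"
    have n: "(norm (\<epsilon> *\<^sub>R s))\<^sup>2 = q \<epsilon>" by (simp add: q_def power_mult_distrib)
    define W where "W = h' (q \<epsilon>) - h' 0"
    have d: "W / q \<epsilon> * (norm s)\<^sup>2 = W / \<epsilon>\<^sup>2"
      using False by (simp add: q_def)
    have "grad_cov h' h'' a b (\<epsilon> *\<^sub>R s) - grad_cov h' h'' a b 0
        = \<epsilon>\<^sup>2 * (- 4 * h'' (q \<epsilon>) * (s \<bullet> a) * (s \<bullet> b)) - 2 * W * (a \<bullet> b)"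
      unfolding grad_cov_def n W_def by (simp add: power2_eq_square algebra_simps)
    then have "(grad_cov h' h'' a b (\<epsilon> *\<^sub>R s) - grad_cov h' h'' a b 0) / \<epsilon>\<^sup>2
        = - 4 * h'' (q \<epsilon>) * (s \<bullet> a) * (s \<bullet> b) - 2 * (W / \<epsilon>\<^sup>2) * (a \<bullet> b)"
      using \<open>\<epsilon> \<noteq> 0\<close> by (simp add: diff_divide_distrib)
    then show "- 4 * h'' (q \<epsilon>) * (s \<bullet> a) * (s \<bullet> b)
      - 2 * ((h' (q \<epsilon>) - h' 0) / q \<epsilon>) * (norm s)\<^sup>2 * (a \<bullet> b)
      = (grad_cov h' h'' a b (\<epsilon> *\<^sub>R s) - grad_cov h' h'' a b 0) / \<epsilon>\<^sup>2"
      unfolding W_def[symmetric] d[symmetric] by simp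
  qed
  ultimately show ?thesis by (rule Lim_transform_eventually)
qed

end

section \<open>Covariances of the field, its gradient and its Hessian\<close>

text \<open>
  A field \<open>u\<close> with isotropic covariance, together with versions \<open>G\<close> of the gradient and \<open>H\<close> of the
  Hessian of its flip difference. The expansion point \<open>z\<close> is fixed by the flip.
\<close>

locale isotropic_taylor =
  fixes M :: "'a measure"
  and u :: "('d::euclidean_space) \<times> 'd \<Rightarrow> 'a \<Rightarrow> real"
  and h h' h'' :: "real \<Rightarrow> real"
  and z :: "'d \<times> 'd"
  and G :: "'d \<times> 'd \<Rightarrow> 'd \<times> 'd \<Rightarrow> 'a \<Rightarrow> real"
  and H :: "'d \<times> 'd \<Rightarrow> 'd \<times> 'd \<Rightarrow> 'a \<Rightarrow> real"
  assumes prob: "prob_space M"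
    and u_sq: "\<And>x. u x \<in> square_integrable M"
    and mean_u: "\<And>x. integral\<^sup>L M (u x) = 0"
    and cov_u: "\<And>x y. integral\<^sup>L M (\<lambda>\<omega>. u x \<omega> * u y \<omega>) = h ((norm (x - y))\<^sup>2)"
    and C2: "C2_halfline h h' h''"
    and swap_z: "prod.swap z = z"
    and deriv_G: "\<And>i x. i \<in> Basis \<Longrightarrow> has_ms_derivative M (flip_difference u) i x (G i x)"
    and deriv_H: "\<And>i j. i \<in> Basis \<Longrightarrow> j \<in> Basis \<Longrightarrow> has_ms_derivative M (G i) j z (H i j)"
begin

abbreviation f where "f \<equiv> flip_difference u"

abbreviation expectation :: "('a \<Rightarrow> real) \<Rightarrow> real" where "expectation \<equiv> integral\<^sup>L M"

lemma f_sq: "f x \<in> square_integrable M"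
  using square_integrable_diff[OF u_sq u_sq] by (simp add: flip_difference_def[abs_def])

lemma G_sq: "i \<in> Basis \<Longrightarrow> G i x \<in> square_integrable M"
  using ms_derivative_square_integrable(1)[OF f_sq deriv_G] .

lemma H_sq: "i \<in> Basis \<Longrightarrow> j \<in> Basis \<Longrightarrow> H i j \<in> square_integrable M"
  using ms_derivative_square_integrable(1)[OF G_sq deriv_H] .

lemma one_sq: "(\<lambda>_. 1) \<in> square_integrable M"
  using finite_measure.integrable_const[OF prob_space.finite_measure[OF prob]]
  by (simp add: square_integrable_def)

lemma mean_f: "expectation (f x) = 0"
proof -
  have "integrable M (u x)" for x
    using integrable_mult_square_integrable[OF one_sq u_sq] by simp
  then show ?thesis by (simp add: flip_difference_def[abs_def] mean_u)
qed

lemma mean_G: assumes "i \<in> Basis" shows "expectation (G i x) = 0"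
  using DERIV_unique[OF has_real_derivative_integral_ms[OF f_sq deriv_G[OF assms, of x] one_sq]]
  by (simp add: mean_f)

lemma mean_H: assumes "i \<in> Basis" "j \<in> Basis" shows "expectation (H i j) = 0"
  using DERIV_unique[OF has_real_derivative_integral_ms[OF G_sq[OF assms(1)] deriv_H[OF assms] one_sq]]
  by (simp add: mean_G[OF assms(1)])

text \<open>
  The flip is an isometric involution, so the four covariances of \<open>u\<close> at \<open>x, swap x\<close> and
  \<open>y, swap y\<close> coincide in pairs.
\<close>

lemma cov_ff:
  "expectation (\<lambda>\<omega>. f x \<omega> * f y \<omega>)
    = 2 * h ((norm (x - y))\<^sup>2) - 2 * h ((norm (x - prod.swap y))\<^sup>2)"
proof -
  note int = integrable_mult_square_integrable[OF u_sq u_sq]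
  have "expectation (\<lambda>\<omega>. f x \<omega> * f y \<omega>)
      = expectation (\<lambda>\<omega>. u x \<omega> * u y \<omega> - u x \<omega> * u (prod.swap y) \<omega> - u (prod.swap x) \<omega> * u y \<omega>
          + u (prod.swap x) \<omega> * u (prod.swap y) \<omega>)"
    by (intro Bochner_Integration.integral_cong) (simp_all add: flip_difference_def algebra_simps)
  also have "\<dots> = h ((norm (x - y))\<^sup>2) - h ((norm (x - prod.swap y))\<^sup>2)
      - h ((norm (prod.swap x - y))\<^sup>2) + h ((norm (prod.swap x - prod.swap y))\<^sup>2)"
    using int by (simp add: cov_u)
  also have "norm (prod.swap x - y) = norm (x - prod.swap y)"
    using norm_swap[of "x - prod.swap y"] by (simp add: swap_diff)
  also have "norm (prod.swap x - prod.swap y) = norm (x - y)"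
    using norm_swap[of "x - y"] by (simp add: swap_diff)
  finally show ?thesis by simp
qed

text \<open>
  Differentiation of \<open>cov_ff\<close> in \<open>y\<close>. Moving \<open>y\<close> in direction \<open>j\<close> moves \<open>swap y\<close> in
  direction \<open>swap j\<close>.
\<close>

lemma cov_fG:
  assumes "j \<in> Basis"
  shows "expectation (\<lambda>\<omega>. f x \<omega> * G j y \<omega>)
    = 2 * grad_kernel h' j (x - y) - 2 * grad_kernel h' (prod.swap j) (x - prod.swap y)"
proof (rule DERIV_unique[OF has_real_derivative_integral_ms[OF f_sq deriv_G[OF assms] f_sq]])
  have "((\<lambda>\<epsilon>. 2 * h ((norm (x - y - \<epsilon> *\<^sub>R j))\<^sup>2) - 2 * h ((norm (x - prod.swap y - \<epsilon> *\<^sub>R prod.swap j))\<^sup>2))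
    has_real_derivative 2 * grad_kernel h' j (x - y)
      - 2 * grad_kernel h' (prod.swap j) (x - prod.swap y)) (at 0)"
    by (intro DERIV_diff DERIV_cmult covariance_radial_derivative[OF C2])
  then show "((\<lambda>\<epsilon>. expectation (\<lambda>\<omega>. f x \<omega> * f (y + \<epsilon> *\<^sub>R j) \<omega>))
    has_real_derivative 2 * grad_kernel h' j (x - y)
      - 2 * grad_kernel h' (prod.swap j) (x - prod.swap y)) (at 0)"
    unfolding cov_ff by (simp add: swap_linear_simps diff_diff_add)
qed

lemma cov_GG:
  assumes i: "i \<in> Basis" and j: "j \<in> Basis"
  shows "expectation (\<lambda>\<omega>. G i x \<omega> * G j y \<omega>)
    = 2 * grad_cov h' h'' i j (x - y) - 2 * grad_cov h' h'' i (prod.swap j) (x - prod.swap y)"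
proof -
  have "expectation (\<lambda>\<omega>. G j y \<omega> * G i x \<omega>)
    = 2 * grad_cov h' h'' i j (x - y) - 2 * grad_cov h' h'' i (prod.swap j) (x - prod.swap y)"
  proof (rule DERIV_unique[OF has_real_derivative_integral_ms[OF f_sq deriv_G[OF i] G_sq[OF j]]])
    have "((\<lambda>\<epsilon>. 2 * grad_kernel h' j (x - y + \<epsilon> *\<^sub>R i)
        - 2 * grad_kernel h' (prod.swap j) (x - prod.swap y + \<epsilon> *\<^sub>R i))
      has_real_derivative 2 * grad_cov h' h'' i j (x - y)
        - 2 * grad_cov h' h'' i (prod.swap j) (x - prod.swap y)) (at 0)"
      by (intro DERIV_diff DERIV_cmult grad_kernel_derivative[OF C2])
    then show "((\<lambda>\<epsilon>. expectation (\<lambda>\<omega>. G j y \<omega> * f (x + \<epsilon> *\<^sub>R i) \<omega>))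
      has_real_derivative 2 * grad_cov h' h'' i j (x - y)
        - 2 * grad_cov h' h'' i (prod.swap j) (x - prod.swap y)) (at 0)"
      unfolding mult.commute[of "G _ _ _"] cov_fG[OF j] by (simp add: algebra_simps)
  qed
  then show ?thesis by (simp add: mult.commute)
qed

lemma cov_fH:
  assumes i: "i \<in> Basis" and j: "j \<in> Basis"
  shows "expectation (\<lambda>\<omega>. f x \<omega> * H i j \<omega>)
    = - 2 * grad_cov h' h'' j i (x - z) + 2 * grad_cov h' h'' (prod.swap j) (prod.swap i) (x - z)"
proof (rule DERIV_unique[OF has_real_derivative_integral_ms[OF G_sq[OF i] deriv_H[OF i j] f_sq]])
  have "((\<lambda>\<epsilon>. 2 * grad_kernel h' i (x - z + \<epsilon> *\<^sub>R (- j))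
      - 2 * grad_kernel h' (prod.swap i) (x - z + \<epsilon> *\<^sub>R (- prod.swap j)))
    has_real_derivative 2 * grad_cov h' h'' (- j) i (x - z)
      - 2 * grad_cov h' h'' (- prod.swap j) (prod.swap i) (x - z)) (at 0)"
    by (intro DERIV_diff DERIV_cmult grad_kernel_derivative[OF C2])
  then show "((\<lambda>\<epsilon>. expectation (\<lambda>\<omega>. f x \<omega> * G i (z + \<epsilon> *\<^sub>R j) \<omega>))
    has_real_derivative - 2 * grad_cov h' h'' j i (x - z)
      + 2 * grad_cov h' h'' (prod.swap j) (prod.swap i) (x - z)) (at 0)"
    unfolding cov_fG[OF i]
    by (simp add: swap_add swap_scaleR swap_z diff_diff_add grad_cov_def algebra_simps)
qed

text \<open>
  The covariance of \<open>G k z\<close> and \<open>G i (z + \<epsilon> *\<^sub>R j)\<close> is stationary at \<open>\<epsilon> = 0\<close>: it deviates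
  from its value there by \<open>O(\<epsilon>\<^sup>2)\<close>.
\<close>

lemma cov_GH:
  assumes k: "k \<in> Basis" and i: "i \<in> Basis" and j: "j \<in> Basis"
  shows "expectation (\<lambda>\<omega>. G k z \<omega> * H i j \<omega>) = 0"
proof (rule DERIV_unique[OF has_real_derivative_integral_ms[OF G_sq[OF i] deriv_H[OF i j] G_sq[OF k]]])
  have flat: "((\<lambda>\<epsilon>. grad_cov h' h'' a b (\<epsilon> *\<^sub>R s)) has_real_derivative 0) (at 0)"
    for a b s :: "'d \<times> 'd"
  proof -
    have "((\<lambda>\<epsilon>. \<epsilon> * ((grad_cov h' h'' a b (\<epsilon> *\<^sub>R s) - grad_cov h' h'' a b 0) / \<epsilon>\<^sup>2))
      \<longlongrightarrow> 0 * (- 4 * h'' 0 * (s \<bullet> a) * (s \<bullet> b) - 2 * h'' 0 * (norm s)\<^sup>2 * (a \<bullet> b))) (at 0)"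
      by (intro tendsto_mult tendsto_ident_at grad_cov_second_difference[OF C2])
    then have "((\<lambda>\<epsilon>. (grad_cov h' h'' a b (\<epsilon> *\<^sub>R s) - grad_cov h' h'' a b 0) / \<epsilon>) \<longlongrightarrow> 0) (at 0)"
      unfolding mult_zero_left by (rule Lim_transform_eventually)
        (auto simp: eventually_at_filter power2_eq_square)
    then show ?thesis
      by (simp add: has_field_derivative_iff)
  qed
  have "((\<lambda>\<epsilon>. 2 * grad_cov h' h'' k i (\<epsilon> *\<^sub>R (- j))
      - 2 * grad_cov h' h'' k (prod.swap i) (\<epsilon> *\<^sub>R (- prod.swap j)))
    has_real_derivative 2 * 0 - 2 * 0) (at 0)"
    by (intro DERIV_diff DERIV_cmult flat)
  then show "((\<lambda>\<epsilon>. expectation (\<lambda>\<omega>. G k z \<omega> * G i (z + \<epsilon> *\<^sub>R j) \<omega>)) has_real_derivative 0) (at 0)"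
    unfolding cov_GG[OF k i] by (simp add: swap_add swap_scaleR swap_z)
qed

text \<open>
  With equal increments, the second difference of \<open>grad_cov\<close> takes the values at \<open>\<epsilon> *\<^sub>R (j - l)\<close>,
  \<open>- \<epsilon> *\<^sub>R l\<close>, \<open>\<epsilon> *\<^sub>R j\<close> and \<open>0\<close>. Each deviation from the value at \<open>0\<close> is a quadratic form \<open>Q\<close> times \<open>\<epsilon>\<^sup>2\<close>
  to leading order, and the combination polarises \<open>Q\<close>. The flipped kernel contributes the same
  with \<open>swap k, swap l\<close>.
\<close>

lemma cov_HH:
  assumes i: "i \<in> Basis" and j: "j \<in> Basis" and k: "k \<in> Basis" and l: "l \<in> Basis"
  shows "expectation (\<lambda>\<omega>. H i j \<omega> * H k l \<omega>)
    = 8 * h'' 0 * ((i \<bullet> k) * (j \<bullet> l) + (i \<bullet> j) * (k \<bullet> l) + (i \<bullet> l) * (j \<bullet> k))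
    - 8 * h'' 0 * ((i \<bullet> prod.swap k) * (j \<bullet> prod.swap l) + (i \<bullet> j) * (k \<bullet> l)
        + (i \<bullet> prod.swap l) * (j \<bullet> prod.swap k))"
proof -
  define \<Delta> where "\<Delta> a b s \<epsilon> = (grad_cov h' h'' a b (\<epsilon> *\<^sub>R s) - grad_cov h' h'' a b 0) / \<epsilon>\<^sup>2"
    for a b s :: "'d \<times> 'd" and \<epsilon> :: real
  define Q where "Q a b s = - 4 * h'' 0 * (s \<bullet> a) * (s \<bullet> b) - 2 * h'' 0 * (norm s)\<^sup>2 * (a \<bullet> b)"
    for a b s :: "'d \<times> 'd"
  have \<Delta>: "((\<lambda>\<epsilon>. \<Delta> a b s \<epsilon>) \<longlongrightarrow> Q a b s) (at 0)" for a b s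
    unfolding \<Delta>_def Q_def by (rule grad_cov_second_difference[OF C2])
  let ?k = "prod.swap k" and ?l = "prod.swap l"
  have 1: "((\<lambda>\<epsilon>. 2 * (\<Delta> i k (j - l) \<epsilon> - \<Delta> i k (- l) \<epsilon> - \<Delta> i k j \<epsilon>)
        - 2 * (\<Delta> i ?k (j - ?l) \<epsilon> - \<Delta> i ?k (- ?l) \<epsilon> - \<Delta> i ?k j \<epsilon>))
      \<longlongrightarrow> 2 * (Q i k (j - l) - Q i k (- l) - Q i k j)
        - 2 * (Q i ?k (j - ?l) - Q i ?k (- ?l) - Q i ?k j)) (at 0)"
    by (intro tendsto_intros \<Delta>)
  note 2 = tendsto_integral_ms_quotients[OF G_sq[OF i] deriv_H[OF i j] G_sq[OF k] deriv_H[OF k l]]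
  have eq: "2 * (\<Delta> i k (j - l) \<epsilon> - \<Delta> i k (- l) \<epsilon> - \<Delta> i k j \<epsilon>)
        - 2 * (\<Delta> i ?k (j - ?l) \<epsilon> - \<Delta> i ?k (- ?l) \<epsilon> - \<Delta> i ?k j \<epsilon>)
    = (expectation (\<lambda>\<omega>. G i (z + \<epsilon> *\<^sub>R j) \<omega> * G k (z + \<epsilon> *\<^sub>R l) \<omega>)
      - expectation (\<lambda>\<omega>. G i z \<omega> * G k (z + \<epsilon> *\<^sub>R l) \<omega>)
      - expectation (\<lambda>\<omega>. G i (z + \<epsilon> *\<^sub>R j) \<omega> * G k z \<omega>)
      + expectation (\<lambda>\<omega>. G i z \<omega> * G k z \<omega>)) / \<epsilon>\<^sup>2" for \<epsilon>
    unfolding cov_GG[OF i k] \<Delta>_def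
    by (simp add: swap_add swap_scaleR swap_z scaleR_diff_right diff_divide_distrib add_divide_distrib
        right_diff_distrib)
  have "expectation (\<lambda>\<omega>. H i j \<omega> * H k l \<omega>) = 2 * (Q i k (j - l) - Q i k (- l) - Q i k j)
        - 2 * (Q i ?k (j - ?l) - Q i ?k (- ?l) - Q i ?k j)"
    using tendsto_unique[OF _ 2 1[unfolded eq]] by simp
  moreover have "Q a b (s - t) - Q a b (- t) - Q a b s
      = 4 * h'' 0 * ((a \<bullet> b) * (s \<bullet> t) + (a \<bullet> s) * (b \<bullet> t) + (a \<bullet> t) * (s \<bullet> b))" for a b s t
    unfolding Q_def power2_norm_eq_inner by (simp add: inner_simps inner_commute algebra_simps)
  ultimately show ?thesis by (simp add: inner_swap algebra_simps)
qed

text \<open>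
  The error is \<open>X1 + 1/2 * X2 - F\<close>, with gradient part \<open>X1\<close>, Hessian part \<open>X2\<close> and field value \<open>F\<close>,
  all of mean zero, and its square is expanded into pairwise covariances. These are polynomials in
  \<open>a \<bullet> a\<close> and \<open>a \<bullet> s\<close> with coefficients from \<open>h\<close> and its derivatives, where \<open>s = swap a\<close>. In terms of
  \<open>v\<close> and \<open>w\<close>, \<open>a \<bullet> a - a \<bullet> s\<close> and \<open>a \<bullet> a + a \<bullet> s\<close> are \<open>(norm (v - w))\<^sup>2\<close> and \<open>(norm (v + w))\<^sup>2\<close>.
\<close>

lemma variance_taylor_error:
  fixes v w :: 'd
  defines "a \<equiv> (v, w)"
  assumes T: "\<And>\<omega>. T \<omega> = f z \<omega> + (\<Sum>i\<in>Basis. (a \<bullet> i) * G i z \<omega>)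
        + 1/2 * (\<Sum>i\<in>Basis. \<Sum>j\<in>Basis. (a \<bullet> i) * (a \<bullet> j) * H i j \<omega>)"
  shows "prob_space.variance M (\<lambda>\<omega>. T \<omega> - f (z + a) \<omega>) =
       2 * (h 0 - h (2 * (norm (v - w))\<^sup>2))
     - 4 * (h' 0 - 2 * h' ((norm v)\<^sup>2 + (norm w)\<^sup>2)) * (norm (v - w))\<^sup>2
     + 4 * (h'' 0 - 2 * h'' ((norm v)\<^sup>2 + (norm w)\<^sup>2)) * (norm (v - w))\<^sup>2 * (norm (v + w))\<^sup>2"
proof -
  define X1 where "X1 \<omega> = (\<Sum>i\<in>Basis. (a \<bullet> i) * G i z \<omega>)" for \<omega>
  define X2 where "X2 \<omega> = (\<Sum>i\<in>Basis. \<Sum>j\<in>Basis. (a \<bullet> i) * (a \<bullet> j) * H i j \<omega>)" for \<omega>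
  define F where "F = f (z + a)"
  define s where "s = prod.swap a"
  have X1_sq: "X1 \<in> square_integrable M" unfolding X1_def[abs_def]
    by (intro square_integrable_sum square_integrable_cmult G_sq)
  have X2_sq: "X2 \<in> square_integrable M" unfolding X2_def[abs_def]
    by (intro square_integrable_sum square_integrable_cmult H_sq)
  have F_sq: "F \<in> square_integrable M" unfolding F_def by (rule f_sq)
  have int_X1: "expectation (\<lambda>\<omega>. Y \<omega> * X1 \<omega>)
      = (\<Sum>i\<in>Basis. (a \<bullet> i) * expectation (\<lambda>\<omega>. Y \<omega> * G i z \<omega>))"
    if Y: "Y \<in> square_integrable M" for Y
  proof -
    have "Y \<omega> * X1 \<omega> = (\<Sum>i\<in>Basis. (a \<bullet> i) * (Y \<omega> * G i z \<omega>))" for \<omega>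
      by (simp add: X1_def sum_distrib_left algebra_simps)
    then show ?thesis
      using integrable_mult_square_integrable[OF Y G_sq] by simp
  qed
  have int_X2: "expectation (\<lambda>\<omega>. Y \<omega> * X2 \<omega>)
      = (\<Sum>i\<in>Basis. \<Sum>j\<in>Basis. (a \<bullet> i) * (a \<bullet> j) * expectation (\<lambda>\<omega>. Y \<omega> * H i j \<omega>))"
    if Y: "Y \<in> square_integrable M" for Y
  proof -
    have "Y \<omega> * X2 \<omega> = (\<Sum>i\<in>Basis. \<Sum>j\<in>Basis. (a \<bullet> i) * (a \<bullet> j) * (Y \<omega> * H i j \<omega>))" for \<omega>
      by (simp add: X2_def sum_distrib_left algebra_simps)
    then show ?thesis
      using integrable_mult_square_integrable[OF Y H_sq] by simp
  qed
  have F_X1: "expectation (\<lambda>\<omega>. F \<omega> * X1 \<omega>) = - 4 * h' ((norm a)\<^sup>2) * (a \<bullet> a - a \<bullet> s)"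
  proof -
    have "expectation (\<lambda>\<omega>. F \<omega> * X1 \<omega>)
        = (\<Sum>i\<in>Basis. (a \<bullet> i) * (2 * grad_kernel h' i a - 2 * grad_kernel h' (prod.swap i) a))"
      unfolding int_X1[OF F_sq] by (intro sum.cong refl) (simp add: F_def cov_fG swap_z)
    also have "\<dots> = 2 * grad_kernel h' a a - 2 * grad_kernel h' (prod.swap a) a"
      by (rule sum_Basis_linear)
        (intro linearI; simp add: grad_kernel_def swap_linear_simps algebra_simps)+
    finally show ?thesis by (simp add: grad_kernel_def s_def algebra_simps)
  qed
  have F_X2: "expectation (\<lambda>\<omega>. F \<omega> * X2 \<omega>) = 8 * h'' ((norm a)\<^sup>2) * ((a \<bullet> a)\<^sup>2 - (a \<bullet> s)\<^sup>2)"
  proof -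
    have "expectation (\<lambda>\<omega>. F \<omega> * X2 \<omega>)
        = (\<Sum>i\<in>Basis. \<Sum>j\<in>Basis. (a \<bullet> i) * (a \<bullet> j) *
            (- 2 * grad_cov h' h'' j i a + 2 * grad_cov h' h'' (prod.swap j) (prod.swap i) a))"
      unfolding int_X2[OF F_sq] by (intro sum.cong refl) (simp add: F_def cov_fH)
    also have "\<dots> = - 2 * grad_cov h' h'' a a a
        + 2 * grad_cov h' h'' (prod.swap a) (prod.swap a) a"
      by (rule sum_Basis_bilinear)
        (intro linearI; simp add: grad_cov_def swap_linear_simps algebra_simps)+
    finally show ?thesis
      by (simp add: grad_cov_def s_def inner_swap power2_eq_square algebra_simps)
  qed
  have X1_X1: "expectation (\<lambda>\<omega>. X1 \<omega> * X1 \<omega>) = - 4 * h' 0 * (a \<bullet> a - a \<bullet> s)"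
  proof -
    have G_X1: "expectation (\<lambda>\<omega>. X1 \<omega> * G i z \<omega>) = - 4 * h' 0 * (i \<bullet> a - i \<bullet> s)"
      if i: "i \<in> Basis" for i
    proof -
      have "expectation (\<lambda>\<omega>. G i z \<omega> * X1 \<omega>)
          = (\<Sum>j\<in>Basis. (a \<bullet> j) * (- 4 * h' 0 * (i \<bullet> j - i \<bullet> prod.swap j)))"
        unfolding int_X1[OF G_sq[OF i]]
        by (intro sum.cong refl) (subst cov_GG[OF i], assumption,
              simp add: swap_z grad_cov_def right_diff_distrib)
      also have "\<dots> = - 4 * h' 0 * (i \<bullet> a - i \<bullet> prod.swap a)"
        by (rule sum_Basis_linear) (intro linearI; simp add: swap_linear_simps algebra_simps)+
      finally show ?thesis by (simp add: s_def mult.commute)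
    qed
    have "expectation (\<lambda>\<omega>. X1 \<omega> * X1 \<omega>)
        = (\<Sum>i\<in>Basis. (a \<bullet> i) * (- 4 * h' 0 * (i \<bullet> a - i \<bullet> s)))"
      unfolding int_X1[OF X1_sq] by (intro sum.cong refl) (simp add: G_X1)
    also have "\<dots> = - 4 * h' 0 * (a \<bullet> a - a \<bullet> s)"
      by (rule sum_Basis_linear) (intro linearI; simp add: inner_simps algebra_simps)+
    finally show ?thesis .
  qed
  have X1_X2: "expectation (\<lambda>\<omega>. X1 \<omega> * X2 \<omega>) = 0"
  proof -
    have "expectation (\<lambda>\<omega>. X1 \<omega> * H i j \<omega>) = 0" if "i \<in> Basis" "j \<in> Basis" for i j
      using int_X1[OF H_sq[OF that]] cov_GH[OF _ that] by (simp add: mult.commute)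
    then show ?thesis unfolding int_X2[OF X1_sq] by simp
  qed
  have X2_X2: "expectation (\<lambda>\<omega>. X2 \<omega> * X2 \<omega>) = 16 * h'' 0 * ((a \<bullet> a)\<^sup>2 - (a \<bullet> s)\<^sup>2)"
  proof -
    have H_X2: "expectation (\<lambda>\<omega>. X2 \<omega> * H i j \<omega>)
        = 16 * h'' 0 * ((i \<bullet> a) * (j \<bullet> a) - (i \<bullet> s) * (j \<bullet> s))"
      if i: "i \<in> Basis" and j: "j \<in> Basis" for i j
    proof -
      have "expectation (\<lambda>\<omega>. H i j \<omega> * X2 \<omega>)
          = (\<Sum>k\<in>Basis. \<Sum>l\<in>Basis. (a \<bullet> k) * (a \<bullet> l) *
             (8 * h'' 0 * ((i \<bullet> k) * (j \<bullet> l) + (i \<bullet> j) * (k \<bullet> l) + (i \<bullet> l) * (j \<bullet> k))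
            - 8 * h'' 0 * ((i \<bullet> prod.swap k) * (j \<bullet> prod.swap l) + (i \<bullet> j) * (k \<bullet> l)
              + (i \<bullet> prod.swap l) * (j \<bullet> prod.swap k))))"
        unfolding int_X2[OF H_sq[OF i j]] by (intro sum.cong refl) (simp add: cov_HH[OF i j])
      also have "\<dots> = 8 * h'' 0 * ((i \<bullet> a) * (j \<bullet> a) + (i \<bullet> j) * (a \<bullet> a) + (i \<bullet> a) * (j \<bullet> a))
            - 8 * h'' 0 * ((i \<bullet> prod.swap a) * (j \<bullet> prod.swap a) + (i \<bullet> j) * (a \<bullet> a)
              + (i \<bullet> prod.swap a) * (j \<bullet> prod.swap a))"
        by (rule sum_Basis_bilinear)
          (intro linearI; simp add: swap_add swap_scaleR inner_simps algebra_simps)+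
      finally show ?thesis by (simp add: s_def mult.commute algebra_simps)
    qed
    have "expectation (\<lambda>\<omega>. X2 \<omega> * X2 \<omega>)
        = (\<Sum>i\<in>Basis. \<Sum>j\<in>Basis. (a \<bullet> i) * (a \<bullet> j) *
            (16 * h'' 0 * ((i \<bullet> a) * (j \<bullet> a) - (i \<bullet> s) * (j \<bullet> s))))"
      unfolding int_X2[OF X2_sq] by (intro sum.cong refl) (simp add: H_X2)
    also have "\<dots> = 16 * h'' 0 * ((a \<bullet> a) * (a \<bullet> a) - (a \<bullet> s) * (a \<bullet> s))"
      by (rule sum_Basis_bilinear) (intro linearI; simp add: inner_simps algebra_simps)+
    finally show ?thesis by (simp add: power2_eq_square)
  qed
  have F_F: "expectation (\<lambda>\<omega>. F \<omega> * F \<omega>) = 2 * (h 0 - h (2 * (norm (v - w))\<^sup>2))"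
  proof -
    have "z + a - prod.swap (z + a) = (v - w, w - v)"
      by (simp add: swap_add swap_z a_def)
    moreover have "(norm (v - w, w - v))\<^sup>2 = 2 * (norm (v - w))\<^sup>2"
      by (simp add: norm_prod_def norm_minus_commute)
    ultimately show ?thesis unfolding F_def cov_ff by simp
  qed
  have one_eq: "expectation Y = expectation (\<lambda>\<omega>. 1 * Y \<omega>)" for Y :: "'a \<Rightarrow> real" by simp
  have mean: "expectation F = 0" "expectation X1 = 0" "expectation X2 = 0"
    unfolding one_eq[of X1] one_eq[of X2] int_X1[OF one_sq] int_X2[OF one_sq]
    by (simp_all add: F_def mean_f mean_G mean_H)
  note int = integrable_mult_square_integrable
  have int1: "integrable M Y" if "Y \<in> square_integrable M" for Y
    using int[OF one_sq that] by simp
  have err: "T \<omega> - f (z + a) \<omega> = X1 \<omega> + 1/2 * X2 \<omega> - F \<omega>" for \<omega>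
    using T[of \<omega>] by (simp add: X1_def X2_def F_def flip_difference_def swap_z)
  have mean_err: "expectation (\<lambda>\<omega>. X1 \<omega> + 1/2 * X2 \<omega> - F \<omega>) = 0"
    using int1[OF X1_sq] int1[OF X2_sq] int1[OF F_sq] by (simp add: mean)
  have "prob_space.variance M (\<lambda>\<omega>. T \<omega> - f (z + a) \<omega>) = expectation (\<lambda>\<omega>. (X1 \<omega> + 1/2 * X2 \<omega> - F \<omega>)\<^sup>2)"
    by (simp only: err mean_err diff_zero)
  also have "\<dots> = expectation (\<lambda>\<omega>. X1 \<omega> * X1 \<omega> + X1 \<omega> * X2 \<omega> + 1/4 * (X2 \<omega> * X2 \<omega>)
      - 2 * (F \<omega> * X1 \<omega>) - F \<omega> * X2 \<omega> + F \<omega> * F \<omega>)"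
    by (intro Bochner_Integration.integral_cong) (simp_all add: power2_eq_square algebra_simps)
  also have "\<dots> = expectation (\<lambda>\<omega>. X1 \<omega> * X1 \<omega>) + expectation (\<lambda>\<omega>. X1 \<omega> * X2 \<omega>)
      + 1/4 * expectation (\<lambda>\<omega>. X2 \<omega> * X2 \<omega>) - 2 * expectation (\<lambda>\<omega>. F \<omega> * X1 \<omega>)
      - expectation (\<lambda>\<omega>. F \<omega> * X2 \<omega>) + expectation (\<lambda>\<omega>. F \<omega> * F \<omega>)"
    using int[OF X1_sq X1_sq] int[OF X1_sq X2_sq] int[OF X2_sq X2_sq] int[OF F_sq X1_sq]
      int[OF F_sq X2_sq] int[OF F_sq F_sq] by simp
  also have "\<dots> = 2 * (h 0 - h (2 * (norm (v - w))\<^sup>2))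
      - 4 * (h' 0 - 2 * h' ((norm a)\<^sup>2)) * (a \<bullet> a - a \<bullet> s)
      + 4 * (h'' 0 - 2 * h'' ((norm a)\<^sup>2)) * ((a \<bullet> a - a \<bullet> s) * (a \<bullet> a + a \<bullet> s))"
    unfolding X1_X1 X1_X2 X2_X2 F_X1 F_X2 F_F by (simp add: power2_eq_square algebra_simps)
  also have "(norm a)\<^sup>2 = (norm v)\<^sup>2 + (norm w)\<^sup>2"
    by (simp add: a_def norm_prod_def)
  also have "a \<bullet> a - a \<bullet> s = (norm (v - w))\<^sup>2"
    unfolding a_def s_def power2_norm_eq_inner by (simp add: inner_simps inner_commute)
  also have "a \<bullet> a + a \<bullet> s = (norm (v + w))\<^sup>2"
    unfolding a_def s_def power2_norm_eq_inner by (simp add: inner_simps inner_commute)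
  finally show ?thesis by (simp add: mult.assoc)
qed

end

lemma taylor_error_sd_eq_sigma_formula:
  fixes u T :: "('d::euclidean_space) \<times> 'd \<Rightarrow> 'a \<Rightarrow> real"
  assumes "prob_space M" "gaussian_field M u" "\<And>x. integral\<^sup>L M (u x) = 0"
    and "\<And>x y. integral\<^sup>L M (\<lambda>\<omega>. u x \<omega> * u y \<omega>) = h ((norm (x - y))\<^sup>2)"
    and "C2_halfline h h' h''"
    and "is_ms_taylor2 M (flip_difference u) (zs, zs) T"
  shows "taylor_error_sd M (flip_difference u) T zs v w = sigma_formula h h' h'' v w"
proof -
  obtain G H where GH:
    "(\<forall>i\<in>Basis. \<forall>x. has_ms_derivative M (flip_difference u) i x (G i x)) \<and>
     (\<forall>i\<in>Basis. \<forall>j\<in>Basis. has_ms_derivative M (G i) j (zs, zs) (H i j)) \<and>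
     (\<forall>x \<omega>. T x \<omega> = flip_difference u (zs, zs) \<omega>
        + (\<Sum>i\<in>Basis. ((x - (zs, zs)) \<bullet> i) * G i (zs, zs) \<omega>)
        + 1/2 * (\<Sum>i\<in>Basis. \<Sum>j\<in>Basis.
            ((x - (zs, zs)) \<bullet> i) * ((x - (zs, zs)) \<bullet> j) * H i j \<omega>))"
    using assms(6) unfolding is_ms_taylor2_def by (elim exE) (rule that)
  note G = GH[THEN conjunct1, rule_format]
    and H = GH[THEN conjunct2, THEN conjunct1, rule_format]
    and T = GH[THEN conjunct2, THEN conjunct2, rule_format]
  have sq: "u x \<in> square_integrable M" for x
  proof -
    have "gaussian_rv M (\<lambda>\<omega>. \<Sum>y\<in>{x}. 1 * u y \<omega>)"
      by (rule assms(2)[unfolded gaussian_field_def, rule_format]) simp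
    then show ?thesis using gaussian_rv_square_integrable[OF assms(1)] by simp
  qed
  have taylor: "isotropic_taylor M u h h' h'' (zs, zs) G H"
    by (intro isotropic_taylor.intro assms(1,3-5) sq G H) simp_all
  have z: "(zs, zs) + (v, w) = (zs + v, zs + w)" "(zs + v, zs + w) - (zs, zs) = (v, w)"
    by simp_all
  show ?thesis
    unfolding taylor_error_sd_def sigma_formula_def
    by (rule arg_cong[where f = sqrt],
        rule isotropic_taylor.variance_taylor_error[OF taylor, of "T (zs + v, zs + w)" v w, unfolded z(1)])
      (rule T[of "(zs + v, zs + w)", unfolded z(2)])
qed

section \<open>Comparison of the suprema\<close>

lemma sigma_formula_gram_cong:
  fixes v w :: "'x::real_inner" and v' w' :: "'y::real_inner"
  assumes "v' \<bullet> v' = v \<bullet> v" "w' \<bullet> w' = w \<bullet> w" "v' \<bullet> w' = v \<bullet> w"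
  shows "sigma_formula h h' h'' v' w' = sigma_formula h h' h'' v w"
proof -
  have "(norm (v' - w'))\<^sup>2 = (norm (v - w))\<^sup>2" "(norm (v' + w'))\<^sup>2 = (norm (v + w))\<^sup>2"
    "(norm v')\<^sup>2 = (norm v)\<^sup>2" "(norm w')\<^sup>2 = (norm w)\<^sup>2"
    using assms unfolding power2_norm_eq_inner
    by (simp_all add: inner_simps inner_commute)
  then show ?thesis by (simp add: sigma_formula_def)
qed

text \<open>
  A continuous function is bounded on a compact set; here the radicand is continuous because
  \<open>h\<close>, \<open>h'\<close> and \<open>h''\<close> are evaluated only on the half-line.
\<close>

lemma bdd_above_sigma_formula_ellipse:
  assumes C2: "C2_halfline h h' h''" and "a > 0" "b > 0"
  shows "bdd_above ((\<lambda>(v, w). sigma_formula h h' h'' v w) ` (ellipse a b r \<times> ellipse a b r))"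
proof -
  have "closed (ellipse a b r)" unfolding ellipse_def
    using assms by (intro closed_Collect_le continuous_intros) auto
  moreover have "bounded (ellipse a b r)"
    unfolding bounded_iff
  proof (intro exI ballI)
    fix t assume t: "t \<in> ellipse a b r"
    have nn: "0 \<le> (t $ 1)\<^sup>2 / a" "0 \<le> (t $ 2)\<^sup>2 / b" using assms by simp_all
    have "(t $ 1)\<^sup>2 / a \<le> r\<^sup>2" "(t $ 2)\<^sup>2 / b \<le> r\<^sup>2"
      using t nn unfolding ellipse_def mem_Collect_eq by linarith+
    then have "(t $ 1)\<^sup>2 \<le> r\<^sup>2 * a" "(t $ 2)\<^sup>2 \<le> r\<^sup>2 * b"
      using assms by (simp_all add: divide_le_eq)
    then have "(norm t)\<^sup>2 \<le> r\<^sup>2 * a + r\<^sup>2 * b"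
      unfolding power2_norm_eq_inner by (simp add: inner_vec_def sum_2 power2_eq_square)
    then show "norm t \<le> sqrt (r\<^sup>2 * a + r\<^sup>2 * b)" by (rule real_le_rsqrt)
  qed
  ultimately have "compact (ellipse a b r \<times> ellipse a b r)"
    by (intro compact_Times) (simp_all add: compact_eq_bounded_closed)
  moreover have "continuous_on (ellipse a b r \<times> ellipse a b r) (\<lambda>(v, w). sigma_formula h h' h'' v w)"
  proof -
    have c: "continuous_on {0..} h" "continuous_on {0..} h'" "continuous_on {0..} h''"
      using C2 unfolding C2_halfline_def
      by (auto simp: continuous_on_eq_continuous_within intro: DERIV_continuous)
    show ?thesis unfolding sigma_formula_def case_prod_unfold
      by (intro continuous_intros continuous_on_compose2[OF c(1)] continuous_on_compose2[OF c(2)]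
          continuous_on_compose2[OF c(3)]) auto
  qed
  ultimately show ?thesis
    by (intro bounded_imp_bdd_above compact_imp_bounded compact_continuous_image)
qed

lemma ellipse_mono:
  assumes "0 < b" "b \<le> c"
  shows "ellipse a b r \<subseteq> ellipse a c r"
proof
  fix t assume t: "t \<in> ellipse a b r"
  have "(t $ 2)\<^sup>2 / c \<le> (t $ 2)\<^sup>2 / b" using assms by (intro divide_left_mono) auto
  then show "t \<in> ellipse a c r" using t by (simp add: ellipse_def)
qed

theorem proposition32:
  fixes M :: "'a measure"
    and u T :: "(real^'n) \<times> (real^'n) \<Rightarrow> 'a \<Rightarrow> real"
    and h h' h'' :: "real \<Rightarrow> real"
    and zs :: "real^'n"
    and S :: "real^'n^'n"
    and l1 l2 r :: real
  assumes "prob_space M"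
    and "gaussian_field M u"
    and "\<And>x. integral\<^sup>L M (u x) = 0"
    and "\<And>x y. integral\<^sup>L M (\<lambda>\<omega>. u x \<omega> * u y \<omega>) = h ((norm (x - y))\<^sup>2)"
    and "Ck 4 (\<lambda>(x, y). h ((norm (x - y :: (real^'n) \<times> (real^'n)))\<^sup>2))"
    and "C2_halfline h h' h''"
    and "is_ms_taylor2 M (flip_difference u) (zs, zs) T"
    and "CARD('n) \<ge> 2"
    and "symmetric_posdef S"
    and "l1 = eigenvalues_desc S ! 0"
    and "l2 = eigenvalues_desc S ! 1"
    and "r > 0"
  shows "(SUP (v, w)\<in>ellipsoid S r \<times> ellipsoid S r.
            taylor_error_sd M (flip_difference u) T zs v w)
       \<le> (SUP (v, w)\<in>ellipse l1 l2 r \<times> ellipse l1 l2 r. sigma_formula h h' h'' v w)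
     \<and> (SUP (v, w)\<in>ellipse l1 l2 r \<times> ellipse l1 l2 r. sigma_formula h h' h'' v w)
       \<le> (SUP (v, w)\<in>ellipse l1 l1 r \<times> ellipse l1 l1 r. sigma_formula h h' h'' v w)"
proof
  note C2 = assms(6)
  have sym: "transpose S = S" and pd: "\<And>x. x \<noteq> 0 \<Longrightarrow> x \<bullet> (S *v x) > 0"
    using assms(9) by (auto simp: symmetric_posdef_def)
  obtain b :: "'n \<Rightarrow> real^'n" and \<mu> where
    orth: "\<And>i j. b i \<bullet> b j = (if i = j then 1 else 0)" and eig: "\<And>i. S *v b i = \<mu> i *\<^sub>R b i"
    using symmetric_matrix_eigenbasis[OF sym] by blast
  have pos: "\<mu> i > 0" for i
  proof -
    have "b i \<noteq> 0" using orth[of i i] by auto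
    then show ?thesis using pd[of "b i"] orth[of i i] by (simp add: eig)
  qed
  obtain p q where l: "l1 = \<mu> p" "l2 = \<mu> q" and q: "\<mu> q \<le> \<mu> p" "\<And>i. i \<noteq> p \<Longrightarrow> \<mu> i \<le> \<mu> q"
    by (rule two_largest_eigenvalues[OF orth eig assms(8)]) (use assms(10,11) in blast)
  have zero: "0 \<in> ellipsoid S r" "0 \<in> ellipse a c r" for a c
    by (simp_all add: ellipsoid_def ellipse_def)
  show "(SUP (v, w)\<in>ellipsoid S r \<times> ellipsoid S r.
            taylor_error_sd M (flip_difference u) T zs v w)
       \<le> (SUP (v, w)\<in>ellipse l1 l2 r \<times> ellipse l1 l2 r. sigma_formula h h' h'' v w)"
  proof (rule cSUP_least)
    show "ellipsoid S r \<times> ellipsoid S r \<noteq> {}" using zero by auto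
    fix x assume "x \<in> ellipsoid S r \<times> ellipsoid S r"
    then obtain v w where x: "x = (v, w)" and v: "v \<in> ellipsoid S r" and w: "w \<in> ellipsoid S r"
      by auto
    have dim: "DIM(real^'n) \<ge> 2" using assms(8) by simp
    \<comment> \<open>The frame adapted to a leading eigenvector; coordinates in it are the planar images.\<close>
    obtain e t where fr: "e \<bullet> e = 1" "t \<bullet> t = 1" "e \<bullet> t = 0" "t \<bullet> b p = 0"
      and ve: "v = (v \<bullet> e) *\<^sub>R e + (v \<bullet> t) *\<^sub>R t" and we: "w = (w \<bullet> e) *\<^sub>R e + (w \<bullet> t) *\<^sub>R t"
      using planar_frame_orthogonal_to[OF dim] .
    define v' w' :: "real^2" where "v' = vector [v \<bullet> e, v \<bullet> t]" and "w' = vector [w \<bullet> e, w \<bullet> t]"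
    have "v' \<in> ellipse l1 l2 r" "w' \<in> ellipse l1 l2 r"
      unfolding v'_def w'_def l
      using planar_section_in_ellipse[OF sym orth eig pos q fr ve v]
        planar_section_in_ellipse[OF sym orth eig pos q fr we w] by auto
    moreover have "taylor_error_sd M (flip_difference u) T zs v w = sigma_formula h h' h'' v' w'"
      unfolding taylor_error_sd_eq_sigma_formula[OF assms(1-4,6,7)] v'_def w'_def
      by (intro sigma_formula_gram_cong[symmetric] inner_planar_coordinates fr(1-3) ve we)
    ultimately show "(case x of (v, w) \<Rightarrow> taylor_error_sd M (flip_difference u) T zs v w)
        \<le> (SUP (v, w)\<in>ellipse l1 l2 r \<times> ellipse l1 l2 r. sigma_formula h h' h'' v w)"
      unfolding l x using cSUP_upper[OF _ bdd_above_sigma_formula_ellipse[OF C2 pos pos], of "(v', w')"]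
      by simp
  qed
  show "(SUP (v, w)\<in>ellipse l1 l2 r \<times> ellipse l1 l2 r. sigma_formula h h' h'' v w)
       \<le> (SUP (v, w)\<in>ellipse l1 l1 r \<times> ellipse l1 l1 r. sigma_formula h h' h'' v w)"
    unfolding l
  proof (rule cSUP_subset_mono)
    show "ellipse (\<mu> p) (\<mu> q) r \<times> ellipse (\<mu> p) (\<mu> q) r \<noteq> {}" using zero by blast
    show "ellipse (\<mu> p) (\<mu> q) r \<times> ellipse (\<mu> p) (\<mu> q) r
        \<subseteq> ellipse (\<mu> p) (\<mu> p) r \<times> ellipse (\<mu> p) (\<mu> p) r"
      by (intro Sigma_mono ellipse_mono pos q(1))
  qed (rule bdd_above_sigma_formula_ellipse[OF C2 pos pos], rule order.refl)
qed

end
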